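(* Let $\alpha>-1$ and let $f^*\in\mathcal{C}(\mathbb{T})$. Suppose that $f\in\mathcal{C}^2(\mathbb{D})$ solves the Dirichlet problem $\Delta_\alpha f=0$ in $\mathbb{D}$, $f=f^*$ on $\mathbb{T}$ (boundary values in the distributional sense). Then for every $z\in\mathbb{D}$, $$|f(z)|\le {}_2F_1\left(-\frac{\alpha}{2},-\frac{\alpha}{2};1;|z|^2\right)\|f^*\|_\infty .$$
   Context: $\mathbb{D}$ is the open unit disk and $\mathbb{T}$ the unit circle in $\mathbb{C}$; functions are complex-valued; $\mathcal{C}(\mathbb{T})$ is the space of continuous functions on $\mathbb{T}$ and $\mathcal{C}^2(\mathbb{D})$ the space of twice continuously differentiable functions on $\mathbb{D}$. For $\alpha>-1$ the weighted Laplace operator is $\Delta_\alpha=\partial_z(1-|z|^2)^{-\alpha}\overline{\partial}_z$, i.e. $\Delta_\alpha f=\partial_z\big((1-|z|^2)^{-\alpha}\,\overline{\partial}_z f\big)$, where $\partial_z=\frac12(\partial_x-i\partial_y)$ and $\overline{\partial}_z=\frac12(\partial_x+i\partial_y)$. The boundary condition $f=f^*$ on $\mathbb{T}$ means that $f(re^{i\theta})\to f^*(e^{i\theta})$ in the space of distributions $\mathcal{D}'(\mathbb{T})$ as $r\to1^-$. $\|f^*\|_\infty=\operatorname{ess\,sup}_{z\in\mathbb{T}}|f^*(z)|$. The hypergeometric function is ${}_2F_1(a,b;c;x)=\sum_{n=0}^\infty\frac{(a)_n(b)_n}{(c)_n\,n!}x^n$ for $|x|<1$, where $(a)_0=1$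 and $(a)_n=a(a+1)\cdots(a+n-1)$. *)

theory Defs
  imports
    "HOL-Probability.Essential_Supremum"
    "HOL-Computational_Algebra.Formal_Power_Series"
begin

section \<open>The weighted Laplace operator\<close>

definition partial_x :: "(complex \<Rightarrow> complex) \<Rightarrow> complex \<Rightarrow> complex" where
  "partial_x f z = vector_derivative (\<lambda>t. f (Complex t (Im z))) (at (Re z))"

definition partial_y :: "(complex \<Rightarrow> complex) \<Rightarrow> complex \<Rightarrow> complex" where
  "partial_y f z = vector_derivative (\<lambda>t. f (Complex (Re z) t)) (at (Im z))"

definition wirtinger :: "(complex \<Rightarrow> complex) \<Rightarrow> complex \<Rightarrow> complex" where
  "wirtinger f z = (partial_x f z - \<i> * partial_y f z) / 2"

definition wirtinger_bar :: "(complex \<Rightarrow> complex) \<Rightarrow> complex \<Rightarrow> complex" where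
  "wirtinger_bar f z = (partial_x f z + \<i> * partial_y f z) / 2"

definition weighted_laplacian :: "real \<Rightarrow> (complex \<Rightarrow> complex) \<Rightarrow> complex \<Rightarrow> complex" where
  "weighted_laplacian \<alpha> f =
     wirtinger (\<lambda>w. of_real ((1 - (norm w)\<^sup>2) powr (- \<alpha>)) * wirtinger_bar f w)"

text \<open>Real (Frechet) differentiability of order two with continuous second derivative;
  intended for open \<open>S\<close>.\<close>

definition C2_on :: "('a::real_normed_vector \<Rightarrow> 'b::real_normed_vector) \<Rightarrow> 'a set \<Rightarrow> bool" where
  "C2_on f S \<longleftrightarrow>
     (\<exists>(f' :: 'a \<Rightarrow> 'a \<Rightarrow>\<^sub>L 'b) (f'' :: 'a \<Rightarrow> 'a \<Rightarrow>\<^sub>L ('a \<Rightarrow>\<^sub>L 'b)).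
        (\<forall>x\<in>S. (f has_derivative blinfun_apply (f' x)) (at x)) \<and>
        (\<forall>x\<in>S. (f' has_derivative blinfun_apply (f'' x)) (at x)) \<and>
        continuous_on S f'')"

section \<open>Functions and distributions on the unit circle\<close>

text \<open>Arc length, on the Borel sets of the circle itself: functions on the circle are
  represented by functions on the plane whose values off the circle play no role.\<close>

definition circle_measure :: "complex measure" where
  "circle_measure =
     distr (restrict_space lborel {0..<2 * pi}) (restrict_space borel (sphere 0 1)) cis"

definition circle_Linf_norm :: "(complex \<Rightarrow> complex) \<Rightarrow> ereal" where
  "circle_Linf_norm g = esssup circle_measure (\<lambda>\<zeta>. ereal (norm (g \<zeta>)))"

definition circle_test_function :: "(complex \<Rightarrow> complex) \<Rightarrow> bool" where
  "circle_test_function \<phi> \<longleftrightarrow>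
     (\<exists>D :: nat \<Rightarrow> real \<Rightarrow> complex. D 0 = (\<lambda>t. \<phi> (cis t)) \<and>
        (\<forall>n t. (D n has_vector_derivative D (Suc n) t) (at t)))"

text \<open>Continuous functions on the circle act on test functions by integration.\<close>

definition distributional_boundary_value ::
    "(complex \<Rightarrow> complex) \<Rightarrow> (complex \<Rightarrow> complex) \<Rightarrow> bool" where
  "distributional_boundary_value f g \<longleftrightarrow>
     (\<forall>\<phi>. circle_test_function \<phi> \<longrightarrow>
        ((\<lambda>r :: real. \<integral>\<zeta>. f (of_real r * \<zeta>) * \<phi> \<zeta> \<partial>circle_measure)
           \<longlongrightarrow> (\<integral>\<zeta>. g \<zeta> * \<phi> \<zeta> \<partial>circle_measure)) (at_left 1))"

lemma cis_measurable_circle: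
  "cis \<in> restrict_space lborel {0..<2 * pi} \<rightarrow>\<^sub>M restrict_space borel (sphere 0 1)"
proof (rule measurable_restrict_space2)
  have "cis \<in> borel_measurable lborel"
    by (simp add: borel_measurable_continuous_onI continuous_on_cis continuous_on_id)
  then show "cis \<in> restrict_space lborel {0..<2 * pi} \<rightarrow>\<^sub>M borel"
    by (rule measurable_restrict_space1)
qed auto

lemma emeasure_circle_measure_space: "emeasure circle_measure (space circle_measure) = 2 * pi"
proof -
  have vim: "cis -` sphere 0 1 \<inter> {0..<2 * pi} = {0..<2 * pi}"
    by auto
  have "sphere 0 1 \<in> sets (restrict_space borel (sphere (0::complex) 1))"
    using sets.top[of "restrict_space borel (sphere (0::complex) 1)"]
    by (simp add: space_restrict_space)
  then have "emeasure circle_measure (space circle_measure) =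
      emeasure (restrict_space lborel {0..<2 * pi}) {0..<2 * pi}"
    using emeasure_distr[OF cis_measurable_circle, of "sphere 0 1"] vim
    by (simp add: circle_measure_def space_restrict_space)
  also have "\<dots> = 2 * pi"
    by (simp add: emeasure_restrict_space space_restrict_space ennreal_mult)
  finally show ?thesis .
qed

lemma integral_circle_measure:
  fixes g :: "complex \<Rightarrow> complex"
  assumes "continuous_on (sphere 0 1) g"
  shows "(\<integral>\<zeta>. g \<zeta> \<partial>circle_measure) = (LINT t:{0..<2 * pi}|lborel. g (cis t))"
  unfolding circle_measure_def set_lebesgue_integral_def
  by (subst integral_distr[OF cis_measurable_circle
        borel_measurable_continuous_on_restrict[OF assms]])
     (simp add: integral_restrict_space)

section \<open>The hypergeometric function\<close>

definition hyp2F1 :: "real \<Rightarrow> real \<Rightarrow> real \<Rightarrow> real \<Rightarrow> real" where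
  "hyp2F1 a b c x = eval_fps (fps_hypergeo [a, b] [c] 1) x"

lemma hyp2F1_series:
  "hyp2F1 a b c x =
     (\<Sum>n. pochhammer a n * pochhammer b n / (pochhammer c n * fact n) * x ^ n)"
  by (simp add: hyp2F1_def eval_fps_def)

end

(*
  Writing W = (1 - |z|^2)^alpha, the equation says that g = W^{-1} (d-bar f) satisfies d g = 0.
  On circles of radius r both relations become first-order linear ODEs for Fourier coefficients:
  r^k g_k(r) is constant (and zero for k > 0, since g is regular at the origin), which then
  determines the coefficients of f up to one constant each. Letting r -> 1 identifies the constants
  with the Fourier coefficients of the boundary function. The kernel
  P(z) = (1 - |z|^2)^(alpha+1) / ((1 - z) (1 - cnj z)^(alpha+1)) has the same radial profile, so f is
  the convolution of P with its boundary values. Finally |P| = (1 - |z|^2)^(alpha+1) |1 - z|^(-alpha-2)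
  has mean (1 - x)^(alpha+1) 2F1(alpha/2+1, alpha/2+1; 1; x), x = |z|^2, by Parseval, which is
  2F1(-alpha/2, -alpha/2; 1; x) by Euler's transformation.
*)
theory Submission
  imports Defs
begin

section \<open>Uniqueness of Fourier coefficients of continuous functions, by polynomial
  approximation\<close>

section \<open>Fourier coefficients on the circle\<close>

text \<open>No Fourier series of \<open>f\<close> is ever summed. A continuous function on the
  circle whose coefficients all vanish is zero, so \<open>f\<close> is compared with the kernel
  integral on each circle separately, coefficient by coefficient. The decisive point is the profile
  at negative indices. On the side of the equation, integrating the ODE from the origin yields a
  multiple of the integral of \<open>t^m * (1 - t)^\<alpha>\<close> from 0 to r squared, an
  incomplete beta function. On the side of the kernel, Parseval yields the tail of a binomial series
  divided by its full sum. \<open>binomial_tail\<close> is the closed form that joins the two: it is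
  defined as the relative tail, and its derivative collapses to a single beta density. The profile
  tends to 1 at the boundary because \<alpha> + 1 is positive, and this is what allows the free
  constants to be read off from the boundary values. Powers of r are divided out on the way, so the
  origin is left aside and recovered by continuity.\<close>

text \<open>The integral carries no factor 1 / (2 pi). Coefficients of the kernel therefore contain
  a factor 2 pi, which the division in \<open>weighted_poisson_integral\<close> removes.\<close>

definition fourier :: "(complex \<Rightarrow> complex) \<Rightarrow> int \<Rightarrow> complex" where
  "fourier u n = integral {0..2 * pi} (\<lambda>t. u (cis t) * cis (- (of_int n * t)))"

lemma continuous_on_circle_cis:
  assumes "continuous_on (sphere 0 1) u" "continuous_on T h"
  shows "continuous_on T (\<lambda>t. u (cis (h t)))"
  by (rule continuous_on_compose2[OF assms(1)]) (auto intro!: continuous_intros assms)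

lemma fourier_integrable:
  assumes "continuous_on (sphere 0 1) u"
  shows "(\<lambda>t. u (cis t) * cis (- (of_int n * t))) integrable_on {0..2 * pi}"
  by (intro integrable_continuous_interval continuous_intros continuous_on_circle_cis[OF assms])

lemma fourier_add:
  assumes "continuous_on (sphere 0 1) u" "continuous_on (sphere 0 1) v"
  shows "fourier (\<lambda>z. u z + v z) n = fourier u n + fourier v n"
  unfolding fourier_def
  using integral_add[OF fourier_integrable[OF assms(1)] fourier_integrable[OF assms(2)], of n n]
  by (simp add: algebra_simps)

lemma fourier_diff:
  assumes "continuous_on (sphere 0 1) u" "continuous_on (sphere 0 1) v"
  shows "fourier (\<lambda>z. u z - v z) n = fourier u n - fourier v n"
  unfolding fourier_def
  using integral_diff[OF fourier_integrable[OF assms(1)] fourier_integrable[OF assms(2)], of n n]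
  by (simp add: algebra_simps)

lemma fourier_mult_const: "fourier (\<lambda>z. u z * c) n = fourier u n * c"
  unfolding fourier_def by (simp add: integral_mult_left[symmetric] mult_ac)

lemma fourier_mult_ident: "fourier (\<lambda>z. u z * z) n = fourier u (n - 1)"
  proof -
  have "cis t * cis (- (of_int n * t)) = cis (- (of_int (n - 1) * t))" for t
    by (simp add: cis_mult algebra_simps)
  then show ?thesis unfolding fourier_def by (simp add: mult.assoc)
qed

lemma fourier_mult_cnj: "fourier (\<lambda>z. u z * cnj z) n = fourier u (n + 1)"
  proof -
  have "cnj (cis t) * cis (- (of_int n * t)) = cis (- (of_int (n + 1) * t))" for t
    by (simp add: cis_cnj cis_mult algebra_simps)
  then show ?thesis unfolding fourier_def by (simp add: mult.assoc)
qed

text \<open>Multiplication by z or its conjugate only shifts the index, so the vanishing of all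
  coefficients survives it. Since \<open>u\<close> is arbitrary in the induction, products are
  handled by multiplying with one factor after the other.\<close>

lemma fourier_mult_polynomial_eq_0:
  fixes p :: "complex \<Rightarrow> real"
  assumes "real_polynomial_function p" "continuous_on (sphere 0 1) u" "\<forall>n. fourier u n = 0"
  shows "\<forall>n. fourier (\<lambda>z. u z * of_real (p z)) n = 0"
  using assms
proof (induction arbitrary: u rule: real_polynomial_function.induct)
  case (linear p)
  then interpret bounded_linear p by simp
  \<comment> \<open>\<open>c\<close> is the Wirtinger coefficient of the real-linear form
    \<open>p\<close>; it writes \<open>p\<close> as a combination of z and its conjugate.\<close>
  define c where "c = (of_real (p 1) - \<i> * of_real (p \<i>)) / 2"
  have p: "of_real (p z) = z * c + cnj z * cnj c" for z
  proof -
    have "z = Re z *\<^sub>R 1 + Im z *\<^sub>R \<i>" by (simp add: complex_eq_iff)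
    then have "p z = Re z * p 1 + Im z * p \<i>" by (metis add scaleR real_scaleR_def)
    then show ?thesis by (simp add: c_def complex_eq_iff field_simps)
  qed
  have "fourier (\<lambda>z. u z * of_real (p z)) n
      = fourier (\<lambda>z. (u z * z) * c + (u z * cnj z) * cnj c) n" for n
    by (simp add: p algebra_simps)
  also have "\<dots> n = 0" for n
    using linear.prems
    by (subst fourier_add)
       (auto intro!: continuous_intros simp: fourier_mult_const fourier_mult_ident fourier_mult_cnj)
  finally show ?case by simp
next
  case (const c)
  then show ?case by (simp add: fourier_mult_const)
next
  case (add f g)
  have "continuous_on (sphere 0 1) (\<lambda>z. u z * of_real (f z))"
       "continuous_on (sphere 0 1) (\<lambda>z. u z * of_real (g z))"
    using add.prems add.hyps
    by (auto intro!: continuous_intros simp: real_polynomial_function_eq continuous_on_polymonial_function)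
  from fourier_add[OF this] show ?case
    using add.IH[OF add.prems] by (simp add: algebra_simps)
next
  case (mult f g)
  have "continuous_on (sphere 0 1) (\<lambda>z. u z * of_real (f z))"
    using mult.prems mult.hyps
    by (auto intro!: continuous_intros simp: real_polynomial_function_eq continuous_on_polymonial_function)
  from mult.IH(2)[OF this mult.IH(1)[OF mult.prems]] show ?case
    by (simp add: mult.assoc)
qed

lemma integral_of_real_complex:
  fixes f :: "real \<Rightarrow> real"
  assumes "continuous_on {a..b} f"
  shows "integral {a..b} (\<lambda>t. complex_of_real (f t)) = of_real (integral {a..b} f)"
  using integral_linear[OF integrable_continuous_interval[OF assms] bounded_linear_of_real]
  by (simp add: o_def)

lemma norm_eq_1_imp_cis:
  assumes "norm z = 1"
  obtains t where "t \<in> {0..<2 * pi}" "z = cis t"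
  using assms Arg2pi[of z] by (auto simp: cis_conv_exp is_Arg_def)

text \<open>The conjugate of \<open>u\<close> is a uniform limit of polynomials \<open>g\<close>,
  and each integral of \<open>u * g\<close> vanishes. Hence the integral of the squared modulus of
  \<open>u\<close> is arbitrarily small, so it is zero, and continuity gives the claim at every
  point.\<close>

lemma fourier_eq_0_imp_eq_0:
  assumes u: "continuous_on (sphere 0 1) u" and 0: "\<And>n. fourier u n = 0" and z: "norm z = 1"
  shows "u z = 0"
proof -
  have "compact (u ` sphere 0 1)"
    using u by (intro compact_continuous_image) auto
  then obtain B where B: "\<And>z. norm z = 1 \<Longrightarrow> norm (u z) \<le> B"
    by (force dest!: compact_imp_bounded simp: bounded_iff)
  have "B \<ge> 0" using B[of 1] by (smt (verit) norm_ge_zero norm_one)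
  let ?I = "integral {0..2 * pi} (\<lambda>t. u (cis t) * cnj (u (cis t)))"
  have le: "norm ?I \<le> e" if "e > 0" for e
  proof -
    \<comment> \<open>Chosen so that the final error \<open>B * d * 2 * pi\<close> is at most
      \<open>e\<close>; \<open>B + 1\<close> instead of \<open>B\<close> keeps the denominator
      positive.\<close>
    define d where "d = e / (2 * pi * (B + 1))"
    have "d > 0" using that \<open>B \<ge> 0\<close> by (simp add: d_def)
    obtain g where g: "polynomial_function g" "\<And>z. norm z = 1 \<Longrightarrow> norm (cnj (u z) - g z) < d"
      using Stone_Weierstrass_polynomial_function[of "sphere 0 1" "\<lambda>z. cnj (u z)" d] u \<open>d > 0\<close>
      by (auto intro!: continuous_intros)
    have g_cont: "continuous_on (sphere 0 1) g"
      using g continuous_on_polymonial_function by blast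
    have re: "real_polynomial_function (Re \<circ> g)" "real_polynomial_function (Im \<circ> g)"
      using g(1) by (auto simp: polynomial_function_def bounded_linear_Re bounded_linear_Im)
    have "fourier (\<lambda>z. u z * of_real ((Re \<circ> g) z) + (u z * of_real ((Im \<circ> g) z)) * \<i>) 0 = 0"
      using fourier_mult_polynomial_eq_0[OF re(1) u] fourier_mult_polynomial_eq_0[OF re(2) u] 0
      by (subst fourier_add)
         (auto intro!: continuous_intros u g_cont simp: fourier_mult_const)
    also have "(\<lambda>z. u z * of_real ((Re \<circ> g) z) + (u z * of_real ((Im \<circ> g) z)) * \<i>) = (\<lambda>z. u z * g z)"
      by (auto simp: complex_eq_iff algebra_simps)
    finally have "integral {0..2 * pi} (\<lambda>t. u (cis t) * g (cis t)) = 0"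
      by (simp add: fourier_def)
    then have "?I = integral {0..2 * pi} (\<lambda>t. u (cis t) * cnj (u (cis t)) - u (cis t) * g (cis t))"
      by (subst integral_diff) (auto intro!: integrable_continuous_interval continuous_intros continuous_on_circle_cis[OF u] continuous_on_circle_cis[OF g_cont])
    also have "norm \<dots> \<le> (B * d) * (2 * pi - 0)"
    proof (rule integral_bound)
      fix t
      have "norm (u (cis t) * cnj (u (cis t)) - u (cis t) * g (cis t))
          = norm (u (cis t)) * norm (cnj (u (cis t)) - g (cis t))"
        by (simp add: norm_mult[symmetric] right_diff_distrib)
      also have "\<dots> \<le> B * d"
        using B[of "cis t"] g(2)[of "cis t"] \<open>B \<ge> 0\<close> by (intro mult_mono) auto
      finally show "norm (u (cis t) * cnj (u (cis t)) - u (cis t) * g (cis t)) \<le> B * d" .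
    qed (auto intro!: continuous_intros continuous_on_circle_cis[OF u] continuous_on_circle_cis[OF g_cont])
    also have "\<dots> \<le> e"
    proof -
      have "(B * d) * (2 * pi - 0) = e * (B / (B + 1))"
        by (simp add: d_def)
      also have "\<dots> \<le> e * 1"
        using \<open>B \<ge> 0\<close> that by (intro mult_left_mono) (auto simp: field_simps)
      finally show ?thesis by simp
    qed
    finally show ?thesis .
  qed
  have "norm ?I = 0"
    using le[of "norm ?I / 2"] by (cases "norm ?I = 0") auto
  also have "?I = integral {0..2 * pi} (\<lambda>t. of_real ((norm (u (cis t)))\<^sup>2))"
    by (simp only: complex_norm_square)
  also have "\<dots> = of_real (integral {0..2 * pi} (\<lambda>t. (norm (u (cis t)))\<^sup>2))"
    by (intro integral_of_real_complex continuous_intros continuous_on_circle_cis[OF u])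
  finally have "integral {0..2 * pi} (\<lambda>t. (norm (u (cis t)))\<^sup>2) = 0" by simp
  then have "\<forall>t\<in>{0..2 * pi}. (norm (u (cis t)))\<^sup>2 = 0"
    by (subst (asm) integral_eq_0_iff) (auto intro!: continuous_intros continuous_on_circle_cis[OF u])
  moreover obtain t where "t \<in> {0..<2 * pi}" "z = cis t"
    using norm_eq_1_imp_cis z by blast
  ultimately show ?thesis by auto
qed

section \<open>Termwise integration and Parseval's identity\<close>

section \<open>Power series on circles\<close>

lemma has_vector_derivative_cis:
  "((\<lambda>t. cis (c * t)) has_vector_derivative \<i> * of_real c * cis (c * t)) (at t within T)"
proof -
  have "((\<lambda>z. exp (\<i> * of_real c * z)) has_field_derivative \<i> * of_real c * cis (c * t)) (at (of_real t))"
    by (auto intro!: derivative_eq_intros simp: cis_conv_exp mult_ac)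
  from has_vector_derivative_real_field[OF this] show ?thesis
    by (simp add: cis_conv_exp mult_ac)
qed

lemma integral_cis_int:
  "integral {0..2 * pi} (\<lambda>t. cis (of_int n * t)) = (if n = 0 then of_real (2 * pi) else 0)"
proof (cases "n = 0")
  case False
  have "((\<lambda>t. cis (of_int n * t)) has_integral
      cis (of_int n * (2 * pi)) / (\<i> * of_int n) - cis (of_int n * 0) / (\<i> * of_int n)) {0..2 * pi}"
  proof (rule fundamental_theorem_of_calculus)
    fix t
    show "((\<lambda>t. cis (of_int n * t) / (\<i> * of_int n)) has_vector_derivative cis (of_int n * t))
        (at t within {0..2 * pi})"
      using has_vector_derivative_divide[OF has_vector_derivative_cis[of "of_int n" t "{0..2 * pi}"],
          where a = "\<i> * of_int n"] False
      by simp
  qed simp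
  moreover have "cis (of_int n * (2 * pi)) = 1"
    using cis_multiple_2pi[of "of_int n"] by (simp add: mult_ac)
  ultimately show ?thesis using False by (simp add: integral_unique)
qed (auto simp: scaleR_conv_of_real)

lemma continuous_on_circle_power_series:
  fixes a :: "nat \<Rightarrow> complex"
  assumes "summable (\<lambda>k. norm (a k) * norm w ^ k)"
  shows "continuous_on T (\<lambda>t. \<Sum>k. a k * (w * cis t) ^ k)"
proof (rule uniform_limit_theorem[OF _ Weierstrass_m_test])
  show "\<forall>\<^sub>F n in sequentially. continuous_on T (\<lambda>t. \<Sum>k<n. a k * (w * cis t) ^ k)"
    by (intro always_eventually allI continuous_intros)
qed (use assms in \<open>simp_all add: norm_mult norm_power\<close>)

text \<open>Absolute summability at radius \<open>norm w\<close> gives uniform convergence in the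
  angle by the M-test, and the bounded factor \<open>h\<close> does not disturb it.\<close>

lemma integral_power_series_mult:
  fixes a :: "nat \<Rightarrow> complex" and h :: "real \<Rightarrow> complex"
  assumes a: "summable (\<lambda>k. norm (a k) * norm w ^ k)" and h: "continuous_on {0..2 * pi} h"
  shows "(\<lambda>k. a k * w ^ k * integral {0..2 * pi} (\<lambda>t. cis (of_nat k * t) * h t)) sums
    integral {0..2 * pi} (\<lambda>t. (\<Sum>k. a k * (w * cis t) ^ k) * h t)"
proof -
  have "compact (h ` {0..2 * pi})"
    using h by (intro compact_continuous_image) auto
  then obtain B where B: "\<And>t. t \<in> {0..2 * pi} \<Longrightarrow> norm (h t) \<le> B"
    by (force dest!: compact_imp_bounded simp: bounded_iff)
  have sm: "summable (\<lambda>k. a k * (w * cis t) ^ k)" for t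
    by (rule summable_norm_cancel) (use a in \<open>simp add: norm_mult norm_power\<close>)
  have "uniform_limit {0..2 * pi} (\<lambda>n t. \<Sum>k<n. a k * (w * cis t) ^ k * h t)
     (\<lambda>t. \<Sum>k. a k * (w * cis t) ^ k * h t) sequentially"
  proof (rule Weierstrass_m_test)
    show "norm (a k * (w * cis t) ^ k * h t) \<le> norm (a k) * norm w ^ k * B" if "t \<in> {0..2 * pi}" for k t
      using B[OF that] by (simp add: norm_mult norm_power mult_left_mono)
  qed (intro summable_mult2 a)
  then have lim: "uniform_limit {0..2 * pi} (\<lambda>n t. \<Sum>k<n. a k * (w * cis t) ^ k * h t)
     (\<lambda>t. (\<Sum>k. a k * (w * cis t) ^ k) * h t) sequentially"
    by (simp only: suminf_mult2[OF sm])
  have int: "(\<lambda>t. a k * (w * cis t) ^ k * h t) integrable_on {0..2 * pi}" for k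
    by (intro integrable_continuous_interval continuous_intros h)
  obtain I J where I: "\<And>n. ((\<lambda>t. \<Sum>k<n. a k * (w * cis t) ^ k * h t) has_integral I n) {0..2 * pi}"
    and J: "((\<lambda>t. (\<Sum>k. a k * (w * cis t) ^ k) * h t) has_integral J) {0..2 * pi}"
    and IJ: "I \<longlonglongrightarrow> J"
    by (rule uniform_limit_integral[OF lim]) (auto intro!: continuous_intros h)
  have "I n = (\<Sum>k<n. a k * w ^ k * integral {0..2 * pi} (\<lambda>t. cis (of_nat k * t) * h t))" for n
  proof -
    have "I n = integral {0..2 * pi} (\<lambda>t. \<Sum>k<n. a k * (w * cis t) ^ k * h t)"
      using integral_unique[OF I[of n]] by simp
    also have "\<dots> = (\<Sum>k<n. integral {0..2 * pi} (\<lambda>t. a k * (w * cis t) ^ k * h t))"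
      using int by (intro integral_sum) auto
    also have "\<dots> = (\<Sum>k<n. integral {0..2 * pi} (\<lambda>t. (a k * w ^ k) * (cis (of_nat k * t) * h t)))"
      by (simp add: power_mult_distrib Complex.DeMoivre mult_ac)
    finally show ?thesis by simp
  qed
  then have "I = (\<lambda>n. \<Sum>k<n. a k * w ^ k * integral {0..2 * pi} (\<lambda>t. cis (of_nat k * t) * h t))"
    by blast
  then show ?thesis
    using IJ J by (simp add: sums_def integral_unique)
qed

text \<open>Parseval's identity in polarised form. Two different series are needed for the Fourier
  coefficients of the kernel, two equal ones for the mean of its modulus.\<close>

lemma integral_power_series_cnj_power_series:
  fixes a b :: "nat \<Rightarrow> complex"
  assumes a: "summable (\<lambda>k. norm (a k) * norm w ^ k)" and b: "summable (\<lambda>k. norm (b k) * norm w ^ k)"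
  shows "(\<lambda>k. of_real (2 * pi) * (a k * cnj (b k) * of_real (norm w ^ (2 * k)))) sums
    integral {0..2 * pi} (\<lambda>t. (\<Sum>k. a k * (w * cis t) ^ k) * cnj (\<Sum>k. b k * (w * cis t) ^ k))"
proof -
  \<comment> \<open>Orthogonality of the characters extracts the coefficient of index
    \<open>k\<close> from the second series; the first series is then integrated termwise against
    the conjugate of the second.\<close>
  have "integral {0..2 * pi} (\<lambda>t. cis (of_nat k * t) * cnj (\<Sum>j. b j * (w * cis t) ^ j))
      = of_real (2 * pi) * cnj (b k * w ^ k)" for k
  proof -
    have "(\<lambda>j. b j * w ^ j * integral {0..2 * pi} (\<lambda>t. cis (of_nat j * t) * cis (- (of_nat k * t)))) sums
      integral {0..2 * pi} (\<lambda>t. (\<Sum>j. b j * (w * cis t) ^ j) * cis (- (of_nat k * t)))"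
      by (intro integral_power_series_mult b continuous_intros)
    moreover have "integral {0..2 * pi} (\<lambda>t. cis (of_nat j * t) * cis (- (of_nat k * t))) =
        (if j = k then of_real (2 * pi) else 0)" for j
      using integral_cis_int[of "int j - int k"] by (simp add: cis_mult algebra_simps)
    ultimately have "(\<lambda>j. if j = k then b j * w ^ j * of_real (2 * pi) else 0) sums
      integral {0..2 * pi} (\<lambda>t. (\<Sum>j. b j * (w * cis t) ^ j) * cis (- (of_nat k * t)))"
      by (simp add: if_distrib cong: if_cong)
    then have "integral {0..2 * pi} (\<lambda>t. (\<Sum>j. b j * (w * cis t) ^ j) * cis (- (of_nat k * t)))
        = b k * w ^ k * of_real (2 * pi)"
      using sums_single[of k "\<lambda>j. b j * w ^ j * of_real (2 * pi)"] sums_unique2 by blast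
    from arg_cong[OF this, of cnj] show ?thesis
      by (simp add: integral_cnj cis_cnj mult_ac)
  qed
  moreover have "continuous_on {0..2 * pi} (\<lambda>t. cnj (\<Sum>k. b k * (w * cis t) ^ k))"
    by (intro continuous_intros continuous_on_circle_power_series b)
  moreover have "w ^ k * cnj (w ^ k) = of_real (norm w ^ (2 * k))" for k
    by (simp only: complex_norm_square[symmetric] norm_power power_mult[symmetric] mult.commute)
  ultimately show ?thesis
    using integral_power_series_mult[OF a, of "\<lambda>t. cnj (\<Sum>k. b k * (w * cis t) ^ k)"]
    by (simp add: mult_ac)
qed

section \<open>The first-order system behind the equation, and its form in Fourier
  coefficients\<close>

section \<open>Wirtinger derivatives\<close>

text \<open>A Frechet derivative written in the basis \<open>h\<close>, \<open>cnj h\<close>. Unlike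
  the operators built from partial derivatives, which return a value even where nothing is
  differentiable, it supports product and chain rules; \<open>wirtinger_eq\<close> leads back to the
  operators.\<close>

definition has_wirtinger_derivs :: "(complex \<Rightarrow> complex) \<Rightarrow> complex \<Rightarrow> complex \<Rightarrow> complex \<Rightarrow> bool" where
  "has_wirtinger_derivs u p q z \<longleftrightarrow> (u has_derivative (\<lambda>h. p * h + q * cnj h)) (at z)"

lemma real_linear_complex_decomp:
  fixes L :: "complex \<Rightarrow> complex"
  assumes "bounded_linear L"
  shows "L = (\<lambda>h. (L 1 - \<i> * L \<i>) / 2 * h + (L 1 + \<i> * L \<i>) / 2 * cnj h)"
proof
  fix h
  interpret bounded_linear L by fact
  have "h = Re h *\<^sub>R 1 + Im h *\<^sub>R \<i>" by (simp add: complex_eq_iff)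
  then have "L h = Re h *\<^sub>R L 1 + Im h *\<^sub>R L \<i>" by (metis add scaleR)
  then show "L h = (L 1 - \<i> * L \<i>) / 2 * h + (L 1 + \<i> * L \<i>) / 2 * cnj h"
    by (simp add: complex_eq_iff field_simps)
qed

lemma has_wirtinger_derivsI:
  assumes "(u has_derivative L) (at z)"
  shows "has_wirtinger_derivs u ((L 1 - \<i> * L \<i>) / 2) ((L 1 + \<i> * L \<i>) / 2) z"
  unfolding has_wirtinger_derivs_def using assms
  by (subst (asm) real_linear_complex_decomp[OF has_derivative_bounded_linear[OF assms]])

lemma has_wirtinger_derivs_partial:
  assumes "has_wirtinger_derivs u p q z"
  shows "partial_x u z = p + q" "partial_y u z = \<i> * (p - q)"
proof -
  have "((\<lambda>t. Complex t (Im z)) has_vector_derivative 1) (at (Re z))"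
       "((\<lambda>t. Complex (Re z) t) has_vector_derivative \<i>) (at (Im z))"
    unfolding Complex_eq by (auto intro!: derivative_eq_intros)
  note v = this
  have "(u has_derivative (\<lambda>h. p * h + q * cnj h)) (at (Complex (Re z) (Im z)) within T)" for T
    using assms by (simp add: has_wirtinger_derivs_def has_derivative_at_withinI)
  note v[THEN vector_derivative_diff_chain_within, OF this]
  then have "((\<lambda>t. u (Complex t (Im z))) has_vector_derivative p + q) (at (Re z))"
     "((\<lambda>t. u (Complex (Re z) t)) has_vector_derivative \<i> * (p - q)) (at (Im z))"
    by (simp_all add: o_def algebra_simps)
  then show "partial_x u z = p + q" "partial_y u z = \<i> * (p - q)"
    by (simp_all add: partial_x_def partial_y_def vector_derivative_at)
qed

lemma wirtinger_eq:
  assumes "has_wirtinger_derivs u p q z"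
  shows "wirtinger u z = p" "wirtinger_bar u z = q"
  by (simp_all add: wirtinger_def wirtinger_bar_def has_wirtinger_derivs_partial[OF assms] algebra_simps)

lemma C2_on_wirtinger_derivs:
  assumes "C2_on f S"
  obtains p q q1 q2 where
    "continuous_on S p" "continuous_on S q" "continuous_on S q1" "continuous_on S q2"
    "\<And>z. z \<in> S \<Longrightarrow> has_wirtinger_derivs f (p z) (q z) z"
    "\<And>z. z \<in> S \<Longrightarrow> has_wirtinger_derivs q (q1 z) (q2 z) z"
proof -
  obtain f' :: "complex \<Rightarrow> complex \<Rightarrow>\<^sub>L complex" and f'' :: "complex \<Rightarrow> complex \<Rightarrow>\<^sub>L (complex \<Rightarrow>\<^sub>L complex)"
    where f': "\<And>z. z \<in> S \<Longrightarrow> (f has_derivative blinfun_apply (f' z)) (at z)"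
      and f'': "\<And>z. z \<in> S \<Longrightarrow> (f' has_derivative blinfun_apply (f'' z)) (at z)"
      and cont: "continuous_on S f''"
    using assms unfolding C2_on_def by blast
  have cont': "continuous_on S f'"
    using f'' by (meson continuous_at_imp_continuous_on has_derivative_continuous)
  define p where "p = (\<lambda>z. (f' z 1 - \<i> * f' z \<i>) / 2)"
  define q where "q = (\<lambda>z. (f' z 1 + \<i> * f' z \<i>) / 2)"
  define L where "L = (\<lambda>z h. (f'' z h 1 + \<i> * f'' z h \<i>) / 2)"
  have "(q has_derivative L z) (at z)" if "z \<in> S" for z
  proof -
    have *: "((\<lambda>z. f' z h) has_derivative (\<lambda>k. f'' z k h)) (at z)" for h
      using bounded_linear.has_derivative[OF blinfun.bounded_linear_left f''[OF that]] .
    show ?thesis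
      unfolding q_def L_def divide_inverse
      by (intro has_derivative_add has_derivative_mult_right has_derivative_mult_left *)
  qed
  then have "has_wirtinger_derivs q ((L z 1 - \<i> * L z \<i>) / 2) ((L z 1 + \<i> * L z \<i>) / 2) z"
    if "z \<in> S" for z
    using that has_wirtinger_derivsI by blast
  moreover have "continuous_on S (\<lambda>z. (L z 1 - \<i> * L z \<i>) / 2)" "continuous_on S (\<lambda>z. (L z 1 + \<i> * L z \<i>) / 2)"
    unfolding L_def by (intro continuous_intros cont; simp)+
  moreover have "continuous_on S p" "continuous_on S q"
    unfolding p_def q_def by (intro continuous_intros cont'; simp)+
  moreover have "has_wirtinger_derivs f (p z) (q z) z" if "z \<in> S" for z
    using has_wirtinger_derivsI[OF f'[OF that]] by (simp add: p_def q_def)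
  ultimately show ?thesis using that by blast
qed

text \<open>The factor \<open>g\<close> is the weighted d-bar derivative of \<open>f\<close>, and
  the equation says that its d derivative vanishes. Continuity of \<open>p\<close> and
  \<open>q2\<close> is recorded because Fourier integrals are later differentiated under the
  integral sign.\<close>

lemma weighted_laplacian_eq_0_imp:
  assumes "C2_on f (ball 0 1)" "\<And>z. z \<in> ball 0 1 \<Longrightarrow> weighted_laplacian \<alpha> f z = 0"
  obtains p g q2 where
    "continuous_on (ball 0 1) p" "continuous_on (ball 0 1) q2"
    "\<And>z. z \<in> ball 0 1 \<Longrightarrow>
      has_wirtinger_derivs f (p z) (of_real ((1 - (norm z)\<^sup>2) powr \<alpha>) * g z) z"
    "\<And>z. z \<in> ball 0 1 \<Longrightarrow> has_wirtinger_derivs g 0 (q2 z) z"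
proof -
  obtain p q q1 q2 where cont: "continuous_on (ball 0 1) p" "continuous_on (ball 0 1) q"
      "continuous_on (ball 0 1) q1" "continuous_on (ball 0 1) q2"
    and f: "\<And>z. z \<in> ball 0 1 \<Longrightarrow> has_wirtinger_derivs f (p z) (q z) z"
    and q: "\<And>z. z \<in> ball 0 1 \<Longrightarrow> has_wirtinger_derivs q (q1 z) (q2 z) z"
    using C2_on_wirtinger_derivs[OF assms(1)] by metis
  define W :: "real \<Rightarrow> complex \<Rightarrow> complex" where "W = (\<lambda>\<beta> z. of_real ((1 - (norm z)\<^sup>2) powr \<beta>))"
  define g where "g = (\<lambda>z. W (-\<alpha>) z * q z)"
  \<comment> \<open>\<open>g1\<close> and \<open>g2\<close> come from the product rule, the weight
    having differential
    \<open>\<alpha> * W (-\<alpha> - 1) z * (cnj z * h + z * cnj h)\<close>.\<close>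
  define g1 where "g1 = (\<lambda>z. W (-\<alpha>) z * q1 z + of_real \<alpha> * W (-\<alpha> - 1) z * cnj z * q z)"
  define g2 where "g2 = (\<lambda>z. W (-\<alpha>) z * q2 z + of_real \<alpha> * W (-\<alpha> - 1) z * z * q z)"
  have pos: "1 - (norm z)\<^sup>2 > 0" if "z \<in> ball 0 1" for z :: complex
    using that by (simp add: abs_square_less_1)
  have contW: "continuous_on (ball 0 1) (W \<beta>)" for \<beta>
    unfolding W_def by (intro continuous_intros) (use pos in force)
  have g: "has_wirtinger_derivs g (g1 z) (g2 z) z" if z: "z \<in> ball 0 1" for z
  proof -
    have "((\<lambda>z. 1 - (norm z)\<^sup>2) has_derivative (\<lambda>h. - (2 * (z \<bullet> h)))) (at z)"
      unfolding power2_norm_eq_inner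
      by (auto intro!: derivative_eq_intros simp: inner_commute)
    then have "((\<lambda>z. (1 - (norm z)\<^sup>2) powr (-\<alpha>)) has_derivative
        (\<lambda>h. (1 - (norm z)\<^sup>2) powr (-\<alpha>) * (0 * ln (1 - (norm z)\<^sup>2) + - (2 * (z \<bullet> h)) * (-\<alpha>) / (1 - (norm z)\<^sup>2))))
        (at z)"
      by (rule has_derivative_powr) (use pos[OF z] in auto)
    then have "(W (-\<alpha>) has_derivative
        (\<lambda>h. of_real ((1 - (norm z)\<^sup>2) powr (-\<alpha>) * (0 * ln (1 - (norm z)\<^sup>2) + - (2 * (z \<bullet> h)) * (-\<alpha>) / (1 - (norm z)\<^sup>2)))))
        (at z)"
      unfolding W_def by (rule has_derivative_of_real)
    also have "(\<lambda>h. of_real ((1 - (norm z)\<^sup>2) powr (-\<alpha>) * (0 * ln (1 - (norm z)\<^sup>2) + - (2 * (z \<bullet> h)) * (-\<alpha>) / (1 - (norm z)\<^sup>2))))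
      = (\<lambda>h. of_real \<alpha> * W (-\<alpha> - 1) z * (cnj z * h + z * cnj h))"
    proof
      fix h
      have "cnj z * h + z * cnj h = of_real (2 * (z \<bullet> h))"
        by (simp add: complex_eq_iff inner_complex_def)
      moreover have "(1 - (norm z)\<^sup>2) powr (-\<alpha>) / (1 - (norm z)\<^sup>2) = (1 - (norm z)\<^sup>2) powr (-\<alpha> - 1)"
        using pos[OF z] by (simp add: powr_diff)
      moreover have "(1 - (norm z)\<^sup>2) powr (-\<alpha>) * (0 * ln (1 - (norm z)\<^sup>2) + - (2 * (z \<bullet> h)) * (-\<alpha>) / (1 - (norm z)\<^sup>2))
          = \<alpha> * ((1 - (norm z)\<^sup>2) powr (-\<alpha>) / (1 - (norm z)\<^sup>2)) * (2 * (z \<bullet> h))"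
        by simp
      ultimately show "of_real ((1 - (norm z)\<^sup>2) powr (-\<alpha>) * (0 * ln (1 - (norm z)\<^sup>2) + - (2 * (z \<bullet> h)) * (-\<alpha>) / (1 - (norm z)\<^sup>2)))
        = of_real \<alpha> * W (-\<alpha> - 1) z * (cnj z * h + z * cnj h)"
        unfolding W_def by (simp only: of_real_mult)
    qed
    finally have "(W (-\<alpha>) has_derivative (\<lambda>h. of_real \<alpha> * W (-\<alpha> - 1) z * (cnj z * h + z * cnj h))) (at z)" .
    from has_derivative_mult[OF this q[OF z, unfolded has_wirtinger_derivs_def]]
    show ?thesis unfolding g_def g1_def g2_def has_wirtinger_derivs_def
      by (simp add: algebra_simps)
  qed
  have "g1 z = 0" if z: "z \<in> ball 0 1" for z
  proof -
    \<comment> \<open>The operator is applied to \<open>wirtinger_bar f\<close>, which is known to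
      agree with \<open>q\<close> only inside the disk; openness of the disk transfers the
      derivative.\<close>
    have "has_wirtinger_derivs (\<lambda>w. of_real ((1 - (norm w)\<^sup>2) powr (- \<alpha>)) * wirtinger_bar f w) (g1 z) (g2 z) z"
      using g[OF z] unfolding has_wirtinger_derivs_def
      by (rule has_derivative_transform_within_open[OF _ open_ball z])
         (simp add: g_def W_def wirtinger_eq(2)[OF f])
    from wirtinger_eq(1)[OF this] show ?thesis
      using assms(2)[OF z] by (simp add: weighted_laplacian_def)
  qed
  moreover have "of_real ((1 - (norm z)\<^sup>2) powr \<alpha>) * g z = q z" if "z \<in> ball 0 1" for z
  proof -
    have "of_real ((1 - (norm z)\<^sup>2) powr \<alpha>) * g z
      = of_real ((1 - (norm z)\<^sup>2) powr \<alpha> * (1 - (norm z)\<^sup>2) powr (-\<alpha>)) * q z"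
      by (simp add: g_def W_def)
    also have "(1 - (norm z)\<^sup>2) powr \<alpha> * (1 - (norm z)\<^sup>2) powr (-\<alpha>) = 1"
      using pos[OF that] by (simp flip: powr_add)
    finally show ?thesis by simp
  qed
  moreover have "continuous_on (ball 0 1) g2"
    unfolding g2_def by (intro continuous_intros cont contW)
  ultimately show ?thesis
    using that[of p g2 g] cont(1) f g by metis
qed

text \<open>In polar coordinates the radial derivative of \<open>u\<close> is
  \<open>p * cis t + q * cis (- t)\<close>, and the angular one is
  \<open>\<i> * r * (p * cis t - q * cis (- t))\<close>; the factors \<open>cis t\<close> and
  \<open>cis (- t)\<close> shift the index. The range of \<open>r\<close> contains a neighbourhood
  of 0, which later provides regularity of the coefficients at the origin.\<close>

lemma fourier_radial_derivative:
  assumes u: "\<And>z. z \<in> ball 0 1 \<Longrightarrow> has_wirtinger_derivs u (p z) (q z) z"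
    and p: "continuous_on (ball 0 1) p" and q: "continuous_on (ball 0 1) q"
    and r: "\<bar>r\<bar> < 1"
  shows "((\<lambda>r. fourier (\<lambda>\<zeta>. u (of_real r * \<zeta>)) n) has_vector_derivative
      fourier (\<lambda>\<zeta>. p (of_real r * \<zeta>)) (n - 1) + fourier (\<lambda>\<zeta>. q (of_real r * \<zeta>)) (n + 1)) (at r)"
    and "of_int n * fourier (\<lambda>\<zeta>. u (of_real r * \<zeta>)) n =
      of_real r * (fourier (\<lambda>\<zeta>. p (of_real r * \<zeta>)) (n - 1) - fourier (\<lambda>\<zeta>. q (of_real r * \<zeta>)) (n + 1))"
proof -
  have du: "(u has_derivative (\<lambda>h. p z * h + q z * cnj h)) (at z)" if "z \<in> ball 0 1" for z
    using u[OF that] by (simp add: has_wirtinger_derivs_def)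
  have cu: "continuous_on (ball 0 1) u"
    using du by (meson continuous_at_imp_continuous_on has_derivative_continuous)
  have polar: "continuous_on ({-1<..<1} \<times> {0..2 * pi}) (\<lambda>(r, t). v (of_real r * cis t))"
    if "continuous_on (ball 0 1) v" for v :: "complex \<Rightarrow> complex"
    unfolding split_beta
    by (rule continuous_on_compose2[OF that]) (auto intro!: continuous_intros simp: norm_mult)
  have circ: "continuous_on T (\<lambda>t. v (of_real r * cis t))"
    if "continuous_on (ball 0 1) v" "\<bar>r\<bar> < 1" for v :: "complex \<Rightarrow> complex" and r T
    by (rule continuous_on_compose2[OF that(1)]) (use that(2) in \<open>auto intro!: continuous_intros simp: norm_mult\<close>)
  define P where "P = (\<lambda>r t. p (of_real r * cis t) * cis (- (of_int (n - 1) * t)))"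
  define Q where "Q = (\<lambda>r t. q (of_real r * cis t) * cis (- (of_int (n + 1) * t)))"
  have PQ: "(p z * cis t + q z * cnj (cis t)) * cis (- (of_int n * t)) =
      p z * cis (- (of_int (n - 1) * t)) + q z * cis (- (of_int (n + 1) * t))"
      "(p z * cis t - q z * cnj (cis t)) * cis (- (of_int n * t)) =
      p z * cis (- (of_int (n - 1) * t)) - q z * cis (- (of_int (n + 1) * t))" for z t
    by (simp_all add: cis_cnj cis_mult algebra_simps)
  have intP: "P r integrable_on {0..2 * pi}" and intQ: "Q r integrable_on {0..2 * pi}"
    unfolding P_def Q_def by (intro integrable_continuous_interval continuous_intros circ p q r)+

  have "((\<lambda>r. integral (cbox 0 (2 * pi)) (\<lambda>t. u (of_real r * cis t) * cis (- (of_int n * t)))) has_vector_derivative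
      integral (cbox 0 (2 * pi)) (\<lambda>t. P r t + Q r t)) (at r within {-1<..<1})"
  proof (rule leibniz_rule_vector_derivative)
    fix x t :: real assume x: "x \<in> {-1<..<1}"
    have 1: "((\<lambda>x. of_real x * cis t) has_vector_derivative cis t) (at x within {-1<..<1})"
      unfolding has_vector_derivative_def
      by (auto intro!: derivative_eq_intros simp: scaleR_conv_of_real)
    have 2: "(u has_derivative (\<lambda>h. p (of_real x * cis t) * h + q (of_real x * cis t) * cnj h))
        (at (of_real x * cis t) within (\<lambda>x. of_real x * cis t) ` {-1<..<1})"
      by (rule has_derivative_at_withinI[OF du]) (use x in \<open>auto simp: norm_mult\<close>)
    from vector_derivative_diff_chain_within[OF 1 2] have "((\<lambda>x. u (of_real x * cis t)) has_vector_derivative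
       p (of_real x * cis t) * cis t + q (of_real x * cis t) * cnj (cis t)) (at x within {-1<..<1})"
      by (simp add: o_def)
    from has_vector_derivative_mult_left[OF this, of "cis (- (of_int n * t))"]
    show "((\<lambda>x. u (of_real x * cis t) * cis (- (of_int n * t))) has_vector_derivative P x t + Q x t)
        (at x within {-1<..<1})"
      by (simp only: PQ P_def Q_def)
  next
    fix x :: real assume x: "x \<in> {-1<..<1}"
    then show "(\<lambda>t. u (of_real x * cis t) * cis (- (of_int n * t))) integrable_on cbox 0 (2 * pi)"
      unfolding box_real by (intro integrable_continuous_interval continuous_intros circ cu) auto
  next
    show "continuous_on ({-1<..<1} \<times> cbox 0 (2 * pi)) (\<lambda>(x, t). P x t + Q x t)"
      using polar[OF p] polar[OF q] unfolding P_def Q_def split_beta box_real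
      by (intro continuous_intros) auto
  qed (use r in auto)
  moreover have "at r within {-1<..<1} = at r"
    using r by (intro at_within_open) auto
  ultimately show "((\<lambda>r. fourier (\<lambda>\<zeta>. u (of_real r * \<zeta>)) n) has_vector_derivative
      fourier (\<lambda>\<zeta>. p (of_real r * \<zeta>)) (n - 1) + fourier (\<lambda>\<zeta>. q (of_real r * \<zeta>)) (n + 1)) (at r)"
    using integral_add[OF intP intQ] by (simp add: fourier_def P_def Q_def)

  let ?F = "\<lambda>t. u (of_real r * cis t) * cis (- of_int n * t)"
  \<comment> \<open>The derivative of a periodic function integrates to zero over a full period;
    this is the second identity, an integration by parts in the angle.\<close>
  have FTC: "((\<lambda>t. \<i> * of_real r * (P r t - Q r t) - \<i> * of_int n * ?F t) has_integral ?F (2 * pi) - ?F 0) {0..2 * pi}"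
  proof (rule fundamental_theorem_of_calculus)
    fix t :: real
    have 1: "((\<lambda>t. of_real r * cis (1 * t)) has_vector_derivative of_real r * (\<i> * cis t)) (at t within {0..2 * pi})"
      using has_vector_derivative_mult_right[OF has_vector_derivative_cis[of 1 t "{0..2 * pi}"], of "of_real r"] by simp
    have 2: "(u has_derivative (\<lambda>h. p (of_real r * cis t) * h + q (of_real r * cis t) * cnj h))
        (at (of_real r * cis (1 * t)) within (\<lambda>t. of_real r * cis (1 * t)) ` {0..2 * pi})"
      using r has_derivative_at_withinI[OF du, of "of_real r * cis t"] by (simp add: norm_mult)
    from vector_derivative_diff_chain_within[OF 1 2] have "((\<lambda>t. u (of_real r * cis t)) has_vector_derivative
       p (of_real r * cis t) * (of_real r * (\<i> * cis t)) + q (of_real r * cis t) * cnj (of_real r * (\<i> * cis t)))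
        (at t within {0..2 * pi})"
      by (simp add: o_def)
    from has_vector_derivative_mult[OF this has_vector_derivative_cis[of "- of_int n" t "{0..2 * pi}"]]
    show "(?F has_vector_derivative \<i> * of_real r * (P r t - Q r t) - \<i> * of_int n * ?F t) (at t within {0..2 * pi})"
      unfolding P_def Q_def PQ(2)[symmetric] by (simp add: algebra_simps)
  qed simp
  have "cis (- of_int n * (2 * pi)) = 1"
    using cis_multiple_2pi[of "- of_int n"] by (simp add: mult_ac)
  then have "?F (2 * pi) - ?F 0 = 0"
    using cis_multiple_2pi[of 1] by simp
  then have "integral {0..2 * pi} (\<lambda>t. \<i> * of_real r * (P r t - Q r t) - \<i> * of_int n * ?F t) = 0"
    using integral_unique[OF FTC] by simp
  moreover have "?F integrable_on {0..2 * pi}"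
    by (intro integrable_continuous_interval continuous_intros circ cu r)
  ultimately have "\<i> * of_real r * (integral {0..2 * pi} (P r) - integral {0..2 * pi} (Q r)) - \<i> * of_int n * integral {0..2 * pi} ?F = 0"
    using intP intQ
    by (simp add: integral_diff integrable_diff integrable_on_mult_right integral_mult_right)
  then have "\<i> * (of_int n * integral {0..2 * pi} ?F) = \<i> * (of_real r * (integral {0..2 * pi} (P r) - integral {0..2 * pi} (Q r)))"
    by (simp add: algebra_simps)
  then show "of_int n * fourier (\<lambda>\<zeta>. u (of_real r * \<zeta>)) n =
      of_real r * (fourier (\<lambda>\<zeta>. p (of_real r * \<zeta>)) (n - 1) - fourier (\<lambda>\<zeta>. q (of_real r * \<zeta>)) (n + 1))"
    by (simp add: fourier_def P_def Q_def)
qed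

section \<open>Radial profiles of the Fourier coefficients of a solution\<close>

section \<open>Solutions of the weighted Laplace equation\<close>

text \<open>For 0 \<le> x < 1 this is the tail from index \<open>m\<close> on of the binomial series
  of \<open>(1 - x)^(-s)\<close>, divided by its full sum. For positive \<open>m\<close> and
  \<open>s\<close> it is the regularised incomplete beta function with parameters \<open>m\<close>
  and \<open>s\<close>. The finite sum makes it differentiable by elementary rules.\<close>

definition binomial_tail :: "real \<Rightarrow> nat \<Rightarrow> real \<Rightarrow> real" where
  "binomial_tail s m x = 1 - (1 - x) powr s * (\<Sum>j<m. pochhammer s j / fact j * x ^ j)"

text \<open>Passing from \<open>m\<close> to \<open>m + 1\<close> subtracts one more term, whose
  derivative cancels the previous monomial and leaves the next one. The identity \<open>c\<close>
  below matches the constants for this cancellation.\<close>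

lemma binomial_tail_derivative:
  assumes "x < 1"
  shows "(binomial_tail s (Suc m) has_real_derivative
    (s + real m) * (pochhammer s m / fact m) * (1 - x) powr (s - 1) * x ^ m) (at x)"
proof (induction m)
  case 0
  have "((\<lambda>x. 1 - (1 - x) powr s) has_real_derivative s * (1 - x) powr (s - 1)) (at x)"
    using assms by (auto intro!: derivative_eq_intros)
  then show ?case by (simp add: binomial_tail_def[abs_def])
next
  case (Suc m)
  define c where "c = pochhammer s (Suc m) / fact (Suc m)"
  have c: "(s + real m) * (pochhammer s m / fact m) = real (Suc m) * c"
    by (simp add: c_def pochhammer_Suc divide_simps)
  have "((\<lambda>x. c * ((1 - x) powr s * x ^ Suc m)) has_real_derivative
      c * (- s * (1 - x) powr (s - 1) * x ^ Suc m + (1 - x) powr s * (real (Suc m) * x ^ m))) (at x)"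
    using assms by (auto intro!: derivative_eq_intros simp del: power_Suc simp: algebra_simps)
  from DERIV_diff[OF Suc.IH this]
  have "(binomial_tail s (Suc (Suc m)) has_real_derivative
     (s + real m) * (pochhammer s m / fact m) * (1 - x) powr (s - 1) * x ^ m -
      c * (- s * (1 - x) powr (s - 1) * x ^ Suc m + (1 - x) powr s * (real (Suc m) * x ^ m))) (at x)"
    by (simp add: binomial_tail_def[abs_def] c_def algebra_simps)
  also have "(1 - x) powr s = (1 - x) powr (s - 1) * (1 - x)"
    using assms powr_add[of "1 - x" "s - 1" 1] by simp
  finally show ?case
    unfolding c c_def[symmetric] by (simp add: algebra_simps)
qed

lemma binomial_tail_0: "m > 0 \<Longrightarrow> binomial_tail s m 0 = 0"
  by (simp add: binomial_tail_def power_0_left if_distrib sum.If_cases cong: if_cong)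

text \<open>A positive \<open>s\<close> makes the factor \<open>(1 - x) powr s\<close> vanish in the
  limit; it is applied with s = \<alpha> + 1.\<close>

lemma binomial_tail_tendsto_1:
  assumes "s > 0"
  shows "(binomial_tail s m \<longlongrightarrow> 1) (at_left 1)"
proof -
  have "((\<lambda>x::real. 1 - x) \<longlongrightarrow> 1 - 1) (at_left 1)" by (intro tendsto_intros)
  then have "((\<lambda>x::real. (1 - x) powr s) \<longlongrightarrow> 0 powr s) (at_left 1)"
    using assms by (intro tendsto_powr') (auto simp: eventually_at_left_field intro!: exI[of _ 0])
  then have "((\<lambda>x::real. 1 - (1 - x) powr s * (\<Sum>j<m. pochhammer s j / fact j * x ^ j)) \<longlongrightarrow>
      1 - 0 powr s * (\<Sum>j<m. pochhammer s j / fact j * 1 ^ j)) (at_left 1)"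
    by (intro tendsto_diff tendsto_mult tendsto_sum tendsto_power tendsto_const tendsto_ident_at)
  then show ?thesis using assms by (simp add: binomial_tail_def[abs_def])
qed

text \<open>The integrating factor \<open>r^(-n)\<close> removes the term \<open>n * U\<close> from
  the linear ODE \<open>r * U' = n * U + r * E\<close>.\<close>

lemma weighted_radial_derivative:
  fixes U :: "real \<Rightarrow> complex"
  assumes "r > 0" "(U has_vector_derivative D) (at r)" "of_real r * D = of_int n * U r + of_real r * E"
  shows "((\<lambda>r. of_real r powi (-n) * U r) has_vector_derivative of_real r powi (-n) * E) (at r)"
proof -
  have "((\<lambda>z. z powi (-n)) has_field_derivative of_int (-n) * of_real r powi (-n - 1)) (at (of_real r :: complex))"
    using assms(1) by (auto intro!: derivative_eq_intros)
  from has_vector_derivative_mult[OF has_vector_derivative_real_field[OF this] assms(2)]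
  have "((\<lambda>r. of_real r powi (-n) * U r) has_vector_derivative
      of_real r powi (-n) * D + of_int (-n) * of_real r powi (-n - 1) * U r) (at r)" .
  also have "of_real r powi (-n) * D + of_int (-n) * of_real r powi (-n - 1) * U r
      = of_real r powi (-n - 1) * (of_real r * D - of_int n * U r)"
    using assms(1) power_int_add[of "of_real r :: complex" "-n - 1" 1] by (simp add: algebra_simps)
  also have "\<dots> = of_real r powi (-n) * E"
    using assms(1) power_int_add[of "of_real r :: complex" "-n - 1" 1] assms(3) by simp
  finally show ?thesis .
qed

lemma fourier_0 [simp]: "fourier (\<lambda>_. 0) n = 0"
  by (simp add: fourier_def)

text \<open>With d derivative 0 the radial and angular identities combine to
  \<open>r * G' = - k * G\<close> for the coefficient G of index \<open>k\<close>, so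
  \<open>r^k * G\<close> is constant. For positive \<open>k\<close> that constant is its limit at
  the origin, where G is continuous and \<open>r^k\<close> tends to 0.\<close>

lemma fourier_antiholomorphic:
  assumes g: "\<And>z. z \<in> ball 0 1 \<Longrightarrow> has_wirtinger_derivs g 0 (q z) z"
    and q: "continuous_on (ball 0 1) q"
  obtains \<gamma> where "\<And>r. r \<in> {0<..<1} \<Longrightarrow> fourier (\<lambda>\<zeta>. g (of_real r * \<zeta>)) k = \<gamma> * of_real r powi (-k)"
    "k > 0 \<Longrightarrow> \<gamma> = 0"
proof -
  define \<Gamma> where "\<Gamma> = (\<lambda>r. fourier (\<lambda>\<zeta>. g (of_real r * \<zeta>)) k)"
  define Q where "Q = (\<lambda>r. fourier (\<lambda>\<zeta>. q (of_real r * \<zeta>)) (k + 1))"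
  note rad = fourier_radial_derivative[OF g continuous_on_const q, where n = k]
  have d: "(\<Gamma> has_vector_derivative Q r) (at r)" and e: "of_int k * \<Gamma> r = - of_real r * Q r"
    if "\<bar>r\<bar> < 1" for r
    using rad[OF _ that] by (simp_all add: \<Gamma>_def Q_def)
  have "((\<lambda>r. of_real r powi k * \<Gamma> r) has_vector_derivative 0) (at r within {0<..<1})" if "r \<in> {0<..<1}" for r
    using weighted_radial_derivative[OF _ d, of r "-k" 0] e[of r] that
    by (auto intro: has_vector_derivative_at_within)
  from has_vector_derivative_zero_constant[OF convex_real_interval(8) this]
  obtain \<gamma> where \<gamma>: "\<And>r. r \<in> {0<..<1} \<Longrightarrow> of_real r powi k * \<Gamma> r = \<gamma>" by blast
  have "\<Gamma> r = \<gamma> * of_real r powi (-k)" if "r \<in> {0<..<1}" for r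
    using \<gamma>[OF that] that by (simp add: power_int_minus field_simps)
  moreover have "\<gamma> = 0" if "k > 0"
  proof -
    have "isCont \<Gamma> 0"
      using d[of 0] has_vector_derivative_continuous by fastforce
    then have "((\<lambda>r. of_real r powi k * \<Gamma> r) \<longlongrightarrow> of_real 0 powi k * \<Gamma> 0) (at_right 0)"
      using that
      by (intro tendsto_intros) (auto simp: isCont_def intro: filterlim_mono at_le)
    moreover have "\<forall>\<^sub>F r in at_right 0. of_real r powi k * \<Gamma> r = \<gamma>"
      using \<gamma> by (auto simp: eventually_at_right_field intro!: exI[of _ 1])
    ultimately have "((\<lambda>r::real. \<gamma>) \<longlongrightarrow> 0) (at_right 0)"
      using that by (simp add: tendsto_cong)
    then show ?thesis by (simp add: tendsto_const_iff)
  qed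
  ultimately show ?thesis using that unfolding \<Gamma>_def by blast
qed

text \<open>The coefficient of \<open>f\<close> of index n is driven by that of \<open>g\<close> of
  index n + 1. For n \<ge> 0 the latter vanishes, which leaves a pure power; for negative n it is a
  pure power, and integration against the weight produces the beta profile.\<close>

lemma fourier_weighted_harmonic:
  assumes f: "C2_on f (ball 0 1)" "\<And>z. z \<in> ball 0 1 \<Longrightarrow> weighted_laplacian \<alpha> f z = 0"
    and \<alpha>: "\<alpha> > -1"
  shows "\<exists>c. \<forall>r\<in>{0<..<1}. fourier (\<lambda>\<zeta>. f (of_real r * \<zeta>)) (int n) = c * of_real r ^ n"
    and "\<exists>c. \<forall>r\<in>{0<..<1}. of_real r ^ Suc m * fourier (\<lambda>\<zeta>. f (of_real r * \<zeta>)) (- int (Suc m)) =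
      c * of_real (binomial_tail (\<alpha> + 1) (Suc m) (r\<^sup>2))"
proof -
  obtain p g q where p: "continuous_on (ball 0 1) p" and q: "continuous_on (ball 0 1) q"
    and df: "\<And>z. z \<in> ball 0 1 \<Longrightarrow> has_wirtinger_derivs f (p z) (of_real ((1 - (norm z)\<^sup>2) powr \<alpha>) * g z) z"
    and dg: "\<And>z. z \<in> ball 0 1 \<Longrightarrow> has_wirtinger_derivs g 0 (q z) z"
    by (rule weighted_laplacian_eq_0_imp[OF f]) blast+
  have cg: "continuous_on (ball 0 1) g"
    using has_derivative_continuous[OF dg[unfolded has_wirtinger_derivs_def]]
    by (intro continuous_at_imp_continuous_on) blast
  have cw: "continuous_on (ball 0 1) (\<lambda>z. of_real ((1 - (norm z)\<^sup>2) powr \<alpha>) * g z)"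
    by (intro continuous_intros cg) (auto simp: abs_square_eq_1)
  define U where "U = (\<lambda>n r. fourier (\<lambda>\<zeta>. f (of_real r * \<zeta>)) n)"
  define \<Gamma> where "\<Gamma> = (\<lambda>k r. fourier (\<lambda>\<zeta>. g (of_real r * \<zeta>)) k)"
  have w: "fourier (\<lambda>\<zeta>. of_real ((1 - (norm (of_real r * \<zeta>))\<^sup>2) powr \<alpha>) * g (of_real r * \<zeta>)) k
      = of_real ((1 - r\<^sup>2) powr \<alpha>) * \<Gamma> k r" for r k
    unfolding \<Gamma>_def fourier_def by (simp add: norm_mult mult.assoc)
  have dU: "((\<lambda>r. of_real r powi (-n) * U n r) has_vector_derivative
      of_real r powi (-n) * (2 * of_real ((1 - r\<^sup>2) powr \<alpha>) * \<Gamma> (n + 1) r)) (at r within {0<..<1})"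
    and contU: "isCont (U n) 0"
    if r: "r \<in> {0<..<1}" for n r
  proof -
    note rad = fourier_radial_derivative[OF df p cw, where n = n, unfolded w]
    have "of_int n * U n r = of_real r * (fourier (\<lambda>\<zeta>. p (of_real r * \<zeta>)) (n - 1)
        - of_real ((1 - r\<^sup>2) powr \<alpha>) * \<Gamma> (n + 1) r)"
      using rad(2)[of r] r by (simp add: U_def)
    \<comment> \<open>Eliminating the coefficient of \<open>p\<close> between the radial and angular
      identities leaves twice the d-bar coefficient.\<close>
    then have "of_real r * (fourier (\<lambda>\<zeta>. p (of_real r * \<zeta>)) (n - 1) + of_real ((1 - r\<^sup>2) powr \<alpha>) * \<Gamma> (n + 1) r)
      = of_int n * U n r + of_real r * (2 * of_real ((1 - r\<^sup>2) powr \<alpha>) * \<Gamma> (n + 1) r)"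
      by (simp add: algebra_simps)
    then have "((\<lambda>r. of_real r powi (-n) * U n r) has_vector_derivative
        of_real r powi (-n) * (2 * of_real ((1 - r\<^sup>2) powr \<alpha>) * \<Gamma> (n + 1) r)) (at r)"
      using rad(1)[of r] r unfolding U_def by (intro weighted_radial_derivative) auto
    then show "((\<lambda>r. of_real r powi (-n) * U n r) has_vector_derivative
        of_real r powi (-n) * (2 * of_real ((1 - r\<^sup>2) powr \<alpha>) * \<Gamma> (n + 1) r)) (at r within {0<..<1})"
      by (rule has_vector_derivative_at_within)
    show "isCont (U n) 0"
      using rad(1)[of 0] has_vector_derivative_continuous unfolding U_def by fastforce
  qed
  show "\<exists>c. \<forall>r\<in>{0<..<1}. fourier (\<lambda>\<zeta>. f (of_real r * \<zeta>)) (int n) = c * of_real r ^ n"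
  proof -
    have "\<Gamma> (int n + 1) r = 0" if "r \<in> {0<..<1}" for r
      using fourier_antiholomorphic[OF dg q, of "int n + 1"] that
      by (metis \<Gamma>_def add.commute mult_zero_left of_nat_0_less_iff of_nat_Suc zero_less_Suc)
    then have "((\<lambda>r. of_real r powi (- int n) * U (int n) r) has_vector_derivative 0) (at r within {0<..<1})"
      if "r \<in> {0<..<1}" for r
      using dU[OF that, of "int n"] that by simp
    from has_vector_derivative_zero_constant[OF convex_real_interval(8) this]
    obtain c where "\<And>r. r \<in> {0<..<1} \<Longrightarrow> of_real r powi (- int n) * U (int n) r = c" by blast
    then have "U (int n) r = c * of_real r ^ n" if "r \<in> {0<..<1}" for r
      using that by (force simp: power_int_minus field_simps)
    then show ?thesis unfolding U_def by blast
  qed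
  show "\<exists>c. \<forall>r\<in>{0<..<1}. of_real r ^ Suc m * fourier (\<lambda>\<zeta>. f (of_real r * \<zeta>)) (- int (Suc m)) =
      c * of_real (binomial_tail (\<alpha> + 1) (Suc m) (r\<^sup>2))"
  proof -
    obtain \<gamma> where \<gamma>: "\<And>r. r \<in> {0<..<1} \<Longrightarrow> \<Gamma> (- int m) r = \<gamma> * of_real r ^ m"
      using fourier_antiholomorphic[OF dg q, of "- int m"] unfolding \<Gamma>_def by (metis minus_minus power_int_of_nat)
    \<comment> \<open>\<open>K\<close> is the constant in \<open>binomial_tail_derivative\<close>
      for s = \<alpha> + 1. Dividing by it makes both parts of \<open>H\<close> below have the same
      derivative, the factor 2 r of the chain rule matching the factor 2 of the ODE.\<close>
    define K where "K = (\<alpha> + 1 + real m) * (pochhammer (\<alpha> + 1) m / fact m)"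
    have "K > 0" using \<alpha> by (auto simp: K_def intro!: mult_pos_pos divide_pos_pos pochhammer_pos)
    define c where "c = \<gamma> / of_real K"
    define H where "H = (\<lambda>r. of_real r ^ Suc m * U (- int (Suc m)) r - c * of_real (binomial_tail (\<alpha> + 1) (Suc m) (r\<^sup>2)))"
    have "(H has_vector_derivative 0) (at r within {0<..<1})" if r: "r \<in> {0<..<1}" for r
    proof -
      have "r\<^sup>2 < 1" "- int (Suc m) + 1 = - int m" using r by (simp_all add: abs_square_less_1)
      have "((\<lambda>r. r\<^sup>2) has_real_derivative 2 * r) (at r within {0<..<1})"
        by (auto intro!: derivative_eq_intros)
      from DERIV_chain'[OF this binomial_tail_derivative[OF \<open>r\<^sup>2 < 1\<close>, of "\<alpha> + 1" m]]
      have "((\<lambda>r. binomial_tail (\<alpha> + 1) (Suc m) (r\<^sup>2)) has_real_derivative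
          K * (1 - r\<^sup>2) powr \<alpha> * (r\<^sup>2) ^ m * (2 * r)) (at r within {0<..<1})"
        by (simp add: K_def)
      then have 1: "((\<lambda>r. c * of_real (binomial_tail (\<alpha> + 1) (Suc m) (r\<^sup>2))) has_vector_derivative
          c * of_real (K * (1 - r\<^sup>2) powr \<alpha> * (r\<^sup>2) ^ m * (2 * r))) (at r within {0<..<1})"
        by (intro has_vector_derivative_mult_right has_vector_derivative_of_real)
      have 2: "((\<lambda>r. of_real r ^ Suc m * U (- int (Suc m)) r) has_vector_derivative
          of_real r ^ Suc m * (2 * of_real ((1 - r\<^sup>2) powr \<alpha>) * (\<gamma> * of_real r ^ m))) (at r within {0<..<1})"
        using dU[OF r, of "- int (Suc m)", unfolded \<open>- int (Suc m) + 1 = - int m\<close>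
            \<gamma>[OF r] minus_minus power_int_of_nat] .
      have 3: "c * of_real (K * (1 - r\<^sup>2) powr \<alpha> * (r\<^sup>2) ^ m * (2 * r))
        = of_real r ^ Suc m * (2 * of_real ((1 - r\<^sup>2) powr \<alpha>) * (\<gamma> * of_real r ^ m))"
        using \<open>K > 0\<close> by (simp add: c_def power2_eq_square power_mult_distrib)
      show ?thesis
        using has_vector_derivative_diff[OF 2 1] unfolding H_def 3 diff_self .
    qed
    from has_vector_derivative_zero_constant[OF convex_real_interval(8) this]
    obtain d where d: "\<And>r. r \<in> {0<..<1} \<Longrightarrow> H r = d" by blast
    \<comment> \<open>\<open>H\<close> is constant only on the open interval; continuity identifies
      the constant with \<open>H 0\<close>, which is 0 because the exponent \<open>Suc m\<close> is
      positive.\<close>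
    have "isCont H 0"
    proof -
      have "isCont (U (- int (Suc m))) 0" using contU[of "1/2"] by simp
      moreover have "isCont (\<lambda>r. binomial_tail (\<alpha> + 1) (Suc m) (r\<^sup>2)) 0"
        using isCont_o2[of 0 "\<lambda>r. r\<^sup>2" "binomial_tail (\<alpha> + 1) (Suc m)"]
          DERIV_isCont[OF binomial_tail_derivative[of 0 "\<alpha> + 1" m]] by simp
      ultimately show ?thesis unfolding H_def by (intro continuous_intros)
    qed
    then have "(H \<longlongrightarrow> H 0) (at_right 0)"
      by (auto simp: isCont_def intro: filterlim_mono at_le)
    moreover have "\<forall>\<^sub>F r in at_right 0. H r = d"
      using d by (auto simp: eventually_at_right_field intro!: exI[of _ 1])
    ultimately have "((\<lambda>r::real. d) \<longlongrightarrow> H 0) (at_right 0)"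
      by (simp add: tendsto_cong)
    moreover have "H 0 = 0" by (simp add: H_def binomial_tail_0)
    ultimately have "d = 0" by (simp add: tendsto_const_iff)
    then show ?thesis using d unfolding H_def U_def by (metis right_minus_eq)
  qed
qed

section \<open>Euler's transformation as an identity of formal power series, through the
  hypergeometric equation\<close>

section \<open>Euler's transformation of the hypergeometric series\<close>

text \<open>The n-th coefficient of the left-hand side is the difference of the two sides of the
  recurrence. Both directions serve Euler's transformation: one gives the equation for a factor, the
  other gives the recurrence for the product.\<close>

lemma fps_hypergeometric_ODE_iff:
  fixes F :: "'a::field_char_0 fps"
  shows "fps_X * (1 - fps_X) * fps_deriv (fps_deriv F)
      + (fps_const c - fps_const (a + b + 1) * fps_X) * fps_deriv F - fps_const (a * b) * F = 0 \<longleftrightarrow>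
    (\<forall>n. of_nat (Suc n) * (c + of_nat n) * fps_nth F (Suc n) = (a + of_nat n) * (b + of_nat n) * fps_nth F n)"
    (is "?L = 0 \<longleftrightarrow> ?R")
proof -
  have "fps_nth ?L n = of_nat (Suc n) * (c + of_nat n) * fps_nth F (Suc n) - (a + of_nat n) * (b + of_nat n) * fps_nth F n" for n
  proof -
    have L: "?L = fps_X * fps_deriv (fps_deriv F) - fps_X * (fps_X * fps_deriv (fps_deriv F))
        + fps_const c * fps_deriv F - fps_const (a + b + 1) * (fps_X * fps_deriv F) - fps_const (a * b) * F"
      by (simp add: algebra_simps)
    show "fps_nth ?L n = of_nat (Suc n) * (c + of_nat n) * fps_nth F (Suc n)
        - (a + of_nat n) * (b + of_nat n) * fps_nth F n"
      unfolding L by (cases n rule: nat.exhaust; cases "n - 1") (simp_all add: algebra_simps)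
  qed
  then show ?thesis by (auto simp: fps_eq_iff)
qed

text \<open>The first factor \<open>W\<close> is the binomial series of
  \<open>(1 - x)^(c - a - b)\<close>. Its product with the second series solves the hypergeometric
  equation with parameters a, b, c. As c is not a nonpositive integer, the recurrence determines the
  solution from its constant coefficient.\<close>

lemma fps_hypergeo_Euler:
  fixes a b c :: "'a::field_char_0"
  assumes c: "\<And>n. c \<noteq> - of_nat n"
  shows "fps_hypergeo [a, b] [c] 1 =
    fps_hypergeo [- (c - a - b)] [] 1 * fps_hypergeo [c - a, c - b] [c] 1"
proof -
  have c': "c + of_nat n \<noteq> 0" for n
    using c[of n] by (metis add.commute eq_neg_iff_add_eq_0)
  define s where "s = c - a - b"
  define W where "W = fps_hypergeo [- s] [] (1 :: 'a)"
  define F where "F = fps_hypergeo [c - a, c - b] [c] (1 :: 'a)"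
  have "of_nat (Suc n) * (c + of_nat n) * fps_nth F (Suc n)
      = (c - a + of_nat n) * (c - b + of_nat n) * fps_nth F n" for n
    using c'[of n] unfolding F_def fps_hypergeo_rec by (simp add: divide_simps del: fps_hypergeo_nth of_nat_Suc)
  then have F: "fps_X * (1 - fps_X) * fps_deriv (fps_deriv F)
      + (fps_const c - fps_const (c - a + (c - b) + 1) * fps_X) * fps_deriv F
      - fps_const ((c - a) * (c - b)) * F = 0"
    by (subst fps_hypergeometric_ODE_iff) auto
  have W: "(1 - fps_X) * fps_deriv W = - (fps_const s * W)"
  proof (rule fps_ext)
    fix n
    have "of_nat (Suc n) * fps_nth W (Suc n) = (of_nat n - s) * fps_nth W n"
      unfolding W_def fps_hypergeo_rec by (simp del: fps_hypergeo_nth of_nat_Suc)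
    then show "fps_nth ((1 - fps_X) * fps_deriv W) n = fps_nth (- (fps_const s * W)) n"
      by (cases n) (simp_all add: algebra_simps)
  qed
  let ?u = "1 - fps_X :: 'a fps" and ?G = "W * F"
  have dW: "?u * fps_deriv (fps_deriv W) = fps_deriv W - fps_const s * fps_deriv W"
    using arg_cong[OF W, of fps_deriv] by (simp add: algebra_simps)
  \<comment> \<open>The additional factor \<open>?u\<close> lets the relations for \<open>W\<close>
    eliminate its derivatives without division; it is cancelled afterwards because formal power
    series over a field form a domain.\<close>
  have "?u * (fps_X * ?u * fps_deriv (fps_deriv ?G)
      + (fps_const c - fps_const (a + b + 1) * fps_X) * fps_deriv ?G - fps_const (a * b) * ?G) = 0"
    using F W dW unfolding fps_deriv_mult fps_deriv_add s_def
      fps_const_add[symmetric] fps_const_sub[symmetric] fps_const_mult[symmetric] fps_const_1_eq_1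
    by algebra
  then have "fps_X * ?u * fps_deriv (fps_deriv ?G)
      + (fps_const c - fps_const (a + b + 1) * fps_X) * fps_deriv ?G - fps_const (a * b) * ?G = 0"
    by (metis (no_types, lifting) fps_const_1_eq_1 fps_X_neq_one mult_eq_0_iff right_minus_eq)
  then have G: "of_nat (Suc n) * (c + of_nat n) * fps_nth ?G (Suc n) = (a + of_nat n) * (b + of_nat n) * fps_nth ?G n" for n
    by (simp only: fps_hypergeometric_ODE_iff)
  have "fps_nth (fps_hypergeo [a, b] [c] 1) n = fps_nth ?G n" for n
  proof (induction n)
    case 0
    then show ?case by (simp add: W_def F_def)
  next
    case (Suc n)
    have "fps_nth ?G (Suc n) = (a + of_nat n) * (b + of_nat n) * fps_nth ?G n / (of_nat (Suc n) * (c + of_nat n))"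
      using G[of n] c'[of n] by (simp add: divide_simps del: of_nat_Suc) (simp add: mult_ac del: of_nat_Suc)
    then show ?case
      using Suc.IH unfolding fps_hypergeo_rec by (simp del: fps_hypergeo_nth of_nat_Suc)
  qed
  then show ?thesis by (simp add: fps_eq_iff W_def F_def s_def)
qed

section \<open>Fourier coefficients of the kernel and the mean of its modulus\<close>

section \<open>The weighted Poisson kernel\<close>

lemma neg_binomial_summable:
  fixes z :: complex
  assumes "norm z < 1"
  shows "summable (\<lambda>k. norm (of_real (pochhammer s k / fact k) :: complex) * norm z ^ k)"
proof -
  have "summable (\<lambda>k. norm ((- of_real s gchoose k) * z ^ k))"
    by (rule abs_summable_in_conv_radius)
       (use assms in \<open>simp add: conv_radius_gchoose one_ereal_def\<close>)
  then show ?thesis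
    by (simp add: gbinomial_pochhammer norm_mult norm_divide norm_power pochhammer_of_real)
qed

lemma neg_binomial_sums:
  fixes z :: complex
  assumes "norm z < 1"
  shows "(\<lambda>k. of_real (pochhammer s k / fact k) * z ^ k) sums (1 - z) powr (- of_real s)"
proof -
  have "(- of_real s gchoose k) * (- z) ^ k = of_real (pochhammer s k / fact k) * z ^ k" for k
    by (simp add: gbinomial_pochhammer pochhammer_of_real power_minus[of z])
  then show ?thesis
    using gen_binomial_complex[of "- z" "- of_real s"] assms by simp
qed

lemma neg_binomial_sums_real:
  fixes x :: real
  assumes "\<bar>x\<bar> < 1"
  shows "(\<lambda>k. pochhammer s k / fact k * x ^ k) sums (1 - x) powr (- s)"
proof -
  have "(\<lambda>k. of_real (pochhammer s k / fact k * x ^ k)) sums (of_real ((1 - x) powr (- s)) :: complex)"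
    using neg_binomial_sums[of "of_real x" s] powr_of_real[of "1 - x" "- s"] assms by simp
  then show ?thesis by (simp only: sums_of_real_iff)
qed

text \<open>Absorbs a character into one of the two series, so that Fourier coefficients of a
  product fall under Parseval's identity.\<close>

lemma sums_power_series_shift:
  fixes a :: "nat \<Rightarrow> complex"
  assumes "(\<lambda>k. a k * z ^ k) sums S"
  shows "(\<lambda>k. (if k < m then 0 else a (k - m)) * z ^ k) sums (z ^ m * S)"
proof -
  let ?f = "\<lambda>k. (if k < m then 0 else a (k - m)) * z ^ k"
  have "(\<lambda>k. ?f (k + m)) sums (z ^ m * S)"
    using sums_mult[OF assms, of "z ^ m"] by (simp add: power_add mult_ac)
  then show ?thesis unfolding sums_iff_shift[of ?f] by simp
qed

lemma summable_power_series_shift: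
  fixes a :: "nat \<Rightarrow> complex"
  assumes "summable (\<lambda>k. norm (a k) * r ^ k)"
  shows "summable (\<lambda>k. norm (if k < m then 0 else a (k - m)) * r ^ k)"
proof -
  let ?f = "\<lambda>k. norm (if k < m then 0 else a (k - m)) * r ^ k"
  have "summable (\<lambda>k. ?f (k + m))"
    using summable_mult[OF assms, of "r ^ m"] by (simp add: power_add mult_ac)
  then show ?thesis by (simp only: summable_iff_shift[of ?f])
qed

text \<open>The conjugate stands outside the power, so that the kernel is visibly a power series
  times a conjugated power series. In the disk \<open>1 - z\<close> has positive real part, which
  keeps the principal branch away from its cut. For \<alpha> = 0 this is the classical Poisson
  kernel.\<close>

definition weighted_poisson :: "real \<Rightarrow> complex \<Rightarrow> complex" where
  "weighted_poisson \<alpha> z =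
     of_real ((1 - (norm z)\<^sup>2) powr (\<alpha> + 1)) / (1 - z) * cnj ((1 - z) powr (- of_real (\<alpha> + 1)))"

lemma continuous_on_weighted_poisson: "continuous_on (ball 0 1) (weighted_poisson \<alpha>)"
proof -
  have "1 - (norm z)\<^sup>2 \<noteq> 0" "1 - z \<noteq> 0" if "z \<in> ball 0 1" for z :: complex
    using that by (auto simp: abs_square_eq_1)
  moreover have "norm z < 1 \<Longrightarrow> Re z \<le> 1" for z
    using complex_Re_le_cmod[of z] by simp
  ultimately show ?thesis
    unfolding weighted_poisson_def[abs_def]
    by (intro continuous_on_mult continuous_on_divide continuous_on_cnj continuous_on_of_real
        continuous_on_powr_complex continuous_on_powr continuous_on_diff continuous_on_power
        continuous_on_norm continuous_on_const continuous_on_id)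
       (auto simp: complex_nonpos_Reals_iff)
qed

text \<open>On the circle the kernel is \<open>(1 - x) powr s\<close> times the geometric series
  times the conjugated binomial series. At index \<open>n\<close> the binomial series is shifted and
  its whole sum remains, which the prefactor cancels up to \<open>x^n\<close>. At index
  \<open>- m\<close> the geometric series is shifted, so only the terms from \<open>m\<close> on
  remain, and these form \<open>binomial_tail\<close>.\<close>

lemma fourier_weighted_poisson:
  assumes w: "norm w < 1"
  shows "w \<noteq> 0 \<Longrightarrow> fourier (\<lambda>\<zeta>. weighted_poisson \<alpha> (w * \<zeta>)) (int n) = of_real (2 * pi) * w ^ n"
    and "w ^ m * fourier (\<lambda>\<zeta>. weighted_poisson \<alpha> (w * \<zeta>)) (- int m) =
      of_real (2 * pi * binomial_tail (\<alpha> + 1) m ((norm w)\<^sup>2))"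
proof -
  define s where "s = \<alpha> + 1"
  define x where "x = (norm w)\<^sup>2"
  have x: "0 \<le> x" "x < 1" using w by (simp_all add: x_def abs_square_less_1)
  define b where "b = (\<lambda>k. of_real (pochhammer s k / fact k) :: complex)"
  define B where "B = (\<lambda>z::complex. (1 - z) powr (- of_real s))"
  have x2: "norm w ^ (2 * k) = x ^ k" for k by (simp add: x_def power_mult)
  have circ: "norm (w * cis t) < 1" for t using w by (simp add: norm_mult)
  have sumA: "summable (\<lambda>k. norm (1::complex) * norm w ^ k)"
    using w by (simp add: summable_geometric)
  have sumB: "summable (\<lambda>k. norm (b k) * norm w ^ k)"
    using neg_binomial_summable[OF w] unfolding b_def .
  have A: "(\<lambda>k. 1 * (w * cis t) ^ k) sums (1 / (1 - w * cis t))" for t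
    using geometric_sums[OF circ] by simp
  have B: "(\<lambda>k. b k * (w * cis t) ^ k) sums B (w * cis t)" for t
    using neg_binomial_sums[OF circ] unfolding b_def B_def .
  have bx: "(\<lambda>k. b k * of_real x ^ k) sums of_real ((1 - x) powr (- s))"
    using neg_binomial_sums[of "of_real x" s] powr_of_real[of "1 - x" "- s"] x by (simp add: b_def)
  have cnj_b: "cnj (b k) = b k" for k by (simp add: b_def)
  have W: "of_real ((1 - x) powr s) * of_real ((1 - x) powr (- s)) = (1 :: complex)"
    using x by (simp flip: of_real_mult powr_add)
  have P: "weighted_poisson \<alpha> (w * cis t) = of_real ((1 - x) powr s) * (1 / (1 - w * cis t)) * cnj (B (w * cis t))" for t
    by (simp add: weighted_poisson_def B_def s_def x_def norm_mult)

  show "fourier (\<lambda>\<zeta>. weighted_poisson \<alpha> (w * \<zeta>)) (int n) = of_real (2 * pi) * w ^ n" if "w \<noteq> 0"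
  proof -
    let ?b = "\<lambda>k. if k < n then 0 else b (k - n)"
    have "(\<lambda>k. of_real (2 * pi) * (1 * cnj (?b k) * of_real (norm w ^ (2 * k)))) sums
      integral {0..2 * pi} (\<lambda>t. (\<Sum>k. 1 * (w * cis t) ^ k) * cnj (\<Sum>k. ?b k * (w * cis t) ^ k))"
      by (intro integral_power_series_cnj_power_series sumA summable_power_series_shift sumB)
    moreover have "(\<lambda>k. of_real (2 * pi) * (1 * cnj (?b k) * of_real (norm w ^ (2 * k))))
        = (\<lambda>k. of_real (2 * pi) * (?b k * of_real x ^ k))"
      by (auto simp: x2 cnj_b)
    ultimately have "(\<lambda>k. of_real (2 * pi) * (?b k * of_real x ^ k)) sums
      integral {0..2 * pi} (\<lambda>t. 1 / (1 - w * cis t) * cnj ((w * cis t) ^ n * B (w * cis t)))"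
      using sums_unique[OF A] sums_unique[OF sums_power_series_shift[OF B]] by simp
    then have I: "integral {0..2 * pi} (\<lambda>t. 1 / (1 - w * cis t) * cnj ((w * cis t) ^ n * B (w * cis t)))
        = of_real (2 * pi) * (of_real x ^ n * of_real ((1 - x) powr (- s)))"
      using sums_mult[OF sums_power_series_shift[OF bx]] sums_unique2 by blast
    \<comment> \<open>The factor \<open>cnj w ^ n\<close> completes the character to the n-th power
      of the conjugate of \<open>w * cis t\<close>; it is cancelled at the end, as \<open>w\<close>
      is nonzero.\<close>
    have "cnj w ^ n * fourier (\<lambda>\<zeta>. weighted_poisson \<alpha> (w * \<zeta>)) (int n)
      = integral {0..2 * pi} (\<lambda>t. of_real ((1 - x) powr s) * (1 / (1 - w * cis t) * cnj ((w * cis t) ^ n * B (w * cis t))))"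
      unfolding fourier_def P
      by (simp add: cis_cnj Complex.DeMoivre power_mult_distrib mult_ac flip: integral_mult_right)
    also have "\<dots> = of_real ((1 - x) powr s) * (of_real (2 * pi) * (of_real x ^ n * of_real ((1 - x) powr (- s))))"
      by (simp only: integral_mult_right I)
    also have "\<dots> = of_real (2 * pi) * of_real x ^ n"
      using W by (simp add: mult_ac)
    also have "of_real x ^ n = cnj w ^ n * w ^ n"
      by (simp add: x_def complex_norm_square flip: power_mult_distrib of_real_power) (simp add: mult_ac)
    finally show ?thesis using that by simp
  qed

  show "w ^ m * fourier (\<lambda>\<zeta>. weighted_poisson \<alpha> (w * \<zeta>)) (- int m) =
      of_real (2 * pi * binomial_tail (\<alpha> + 1) m ((norm w)\<^sup>2))"
  proof -
    let ?a = "\<lambda>k. if k < m then 0 else (\<lambda>_. 1) (k - m) :: complex"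
    have "(\<lambda>k. of_real (2 * pi) * (?a k * cnj (b k) * of_real (norm w ^ (2 * k)))) sums
      integral {0..2 * pi} (\<lambda>t. (\<Sum>k. ?a k * (w * cis t) ^ k) * cnj (\<Sum>k. b k * (w * cis t) ^ k))"
      by (intro integral_power_series_cnj_power_series sumB summable_power_series_shift sumA)
    moreover have "(\<lambda>k. of_real (2 * pi) * (?a k * cnj (b k) * of_real (norm w ^ (2 * k))))
        = (\<lambda>k. of_real (2 * pi) * (if k < m then 0 else b k * of_real x ^ k))"
      by (auto simp: x2 cnj_b)
    ultimately have S: "(\<lambda>k. of_real (2 * pi) * (if k < m then 0 else b k * of_real x ^ k)) sums
      integral {0..2 * pi} (\<lambda>t. (w * cis t) ^ m * (1 / (1 - w * cis t)) * cnj (B (w * cis t)))"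
      using sums_unique[OF B] sums_unique[OF sums_power_series_shift[OF A]] by simp
    have "(\<lambda>k. if k \<in> {..<m} then b k * of_real x ^ k else 0) sums (\<Sum>k<m. b k * of_real x ^ k)"
      by (rule sums_If_finite_set) simp
    from sums_diff[OF bx this]
    have "(\<lambda>k. if k < m then 0 else b k * of_real x ^ k) sums
        (of_real ((1 - x) powr (- s)) - (\<Sum>k<m. b k * of_real x ^ k))"
      by (rule back_subst[where P = "\<lambda>f. f sums _"]) auto
    then have I: "integral {0..2 * pi} (\<lambda>t. (w * cis t) ^ m * (1 / (1 - w * cis t)) * cnj (B (w * cis t)))
        = of_real (2 * pi) * (of_real ((1 - x) powr (- s)) - (\<Sum>k<m. b k * of_real x ^ k))"
      using sums_mult S sums_unique2 by blast
    have "w ^ m * fourier (\<lambda>\<zeta>. weighted_poisson \<alpha> (w * \<zeta>)) (- int m)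
      = integral {0..2 * pi} (\<lambda>t. of_real ((1 - x) powr s) * ((w * cis t) ^ m * (1 / (1 - w * cis t)) * cnj (B (w * cis t))))"
      unfolding fourier_def P
      by (simp add: Complex.DeMoivre power_mult_distrib mult_ac flip: integral_mult_right)
    also have "\<dots> = of_real ((1 - x) powr s) * (of_real (2 * pi) * (of_real ((1 - x) powr (- s)) - (\<Sum>k<m. b k * of_real x ^ k)))"
      by (simp only: integral_mult_right I)
    also have "\<dots> = of_real (2 * pi) * (of_real ((1 - x) powr s) * of_real ((1 - x) powr (- s))
        - of_real ((1 - x) powr s) * (\<Sum>k<m. b k * of_real x ^ k))"
      by (simp add: algebra_simps)
    also have "\<dots> = of_real (2 * pi * binomial_tail (\<alpha> + 1) m ((norm w)\<^sup>2))"
      unfolding W by (simp add: binomial_tail_def b_def s_def x_def)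
    finally show ?thesis .
  qed
qed

lemma integral_norm_weighted_poisson:
  assumes w: "norm w < 1"
  shows "integral {0..2 * pi} (\<lambda>t. norm (weighted_poisson \<alpha> (w * cis t))) =
    2 * pi * hyp2F1 (- \<alpha> / 2) (- \<alpha> / 2) 1 ((norm w)\<^sup>2)"
proof -
  \<comment> \<open>\<open>2 * c = 1 + (\<alpha> + 1)\<close> is the total exponent of
    \<open>norm (1 - z)\<close> in the modulus of the kernel, which thereby becomes a squared
    modulus times the weight.\<close>
  define c where "c = \<alpha> / 2 + 1"
  define F where "F = fps_hypergeo [c, c] [1] (1 :: real)"
  define W where "W = fps_hypergeo [- (\<alpha> + 1)] [] (1 :: real)"
  define b where "b = (\<lambda>k. of_real (pochhammer c k / fact k) :: complex)"
  have F_nth: "fps_nth F k = (pochhammer c k / fact k)\<^sup>2" for k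
    by (simp add: F_def power2_eq_square flip: pochhammer_fact)
  have parseval: "(\<lambda>k. 2 * pi * (fps_nth F k * (norm w ^ 2) ^ k)) sums
      integral {0..2 * pi} (\<lambda>t. (norm ((1 - w * cis t) powr (- of_real c)))\<^sup>2)"
    if w: "norm w < 1" for w
  proof -
    have circ: "norm (w * cis t) < 1" for t using w by (simp add: norm_mult)
    have "summable (\<lambda>k. norm (b k) * norm w ^ k)"
      using neg_binomial_summable[OF w] unfolding b_def .
    from integral_power_series_cnj_power_series[OF this this]
    have "(\<lambda>k. of_real (2 * pi * (fps_nth F k * (norm w ^ 2) ^ k))) sums
       integral {0..2 * pi} (\<lambda>t. (1 - w * cis t) powr (- of_real c) * cnj ((1 - w * cis t) powr (- of_real c)))"
      using sums_unique[OF neg_binomial_sums[OF circ, of c]]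
      by (simp add: b_def F_nth power2_eq_square power_mult)
    also have "integral {0..2 * pi} (\<lambda>t. (1 - w * cis t) powr (- of_real c) * cnj ((1 - w * cis t) powr (- of_real c)))
      = integral {0..2 * pi} (\<lambda>t. of_real ((norm ((1 - w * cis t) powr (- of_real c)))\<^sup>2))"
      by (simp only: complex_norm_square)
    also have "\<dots> = of_real (integral {0..2 * pi} (\<lambda>t. (norm ((1 - w * cis t) powr (- of_real c)))\<^sup>2))"
    proof -
      have "0 < Re (1 - w * cis t)" for t
        using complex_Re_le_cmod[of "w * cis t"] circ[of t] by simp
      then show ?thesis
        by (intro integral_of_real_complex continuous_on_power continuous_on_norm continuous_on_powr_complex
          continuous_on_diff continuous_on_const continuous_on_mult continuous_on_cis continuous_on_id)
          (blast intro: less_imp_le, metis zero_complex.sel(1) less_irrefl)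
    qed
    finally show ?thesis by (simp only: sums_of_real_iff)
  qed
  \<comment> \<open>Parseval at radius \<open>sqrt r\<close> already contains the summability at
    \<open>r\<close>; the radius of convergence is needed to evaluate the product of the two formal
    series.\<close>
  have radF: "fps_conv_radius F \<ge> 1"
    unfolding fps_conv_radius_def
  proof (rule conv_radius_geI_ex')
    fix r :: real assume r: "0 < r" "ereal r < 1"
    then have "summable (\<lambda>k. 2 * pi * (fps_nth F k * r ^ k))"
      using parseval[of "of_real (sqrt r)"] by (auto simp: sums_iff)
    then show "summable (\<lambda>k. fps_nth F k * of_real r ^ k)"
      by (subst (asm) summable_cmult_iff) auto
  qed
  have W_nth: "fps_nth W k = pochhammer (- (\<alpha> + 1)) k / fact k" for k by (simp add: W_def)
  have radW: "fps_conv_radius W \<ge> 1"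
    unfolding fps_conv_radius_def W_nth
    by (rule conv_radius_geI_ex') (use neg_binomial_sums_real in \<open>auto simp: sums_iff\<close>)
  define x where "x = (norm w)\<^sup>2"
  have x: "0 \<le> x" "x < 1" using w by (simp_all add: x_def abs_square_less_1)
  then have x_rad: "ereal (norm x) < fps_conv_radius F" "ereal (norm x) < fps_conv_radius W"
    using radF radW less_le_trans[of "ereal (norm x)" 1] by auto
  \<comment> \<open>Euler's transformation with upper parameters - \<alpha> / 2 and lower parameter
    1: the binomial exponent is \<alpha> + 1 and the new upper parameters equal
    \<open>c\<close>.\<close>
  have "hyp2F1 (- \<alpha> / 2) (- \<alpha> / 2) 1 x = eval_fps (W * F) x"
    unfolding hyp2F1_def using fps_hypergeo_Euler[of 1 "- \<alpha> / 2" "- \<alpha> / 2"]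
    by (simp add: W_def F_def c_def add_eq_0_iff algebra_simps)
  also have "\<dots> = eval_fps W x * eval_fps F x"
    by (rule eval_fps_mult[OF x_rad(2,1)])
  also have "eval_fps W x = (1 - x) powr (\<alpha> + 1)"
    using neg_binomial_sums_real[of x "- (\<alpha> + 1)"] x by (simp add: eval_fps_def W_nth sums_iff add.commute)
  also have "2 * pi * eval_fps F x = integral {0..2 * pi} (\<lambda>t. (norm ((1 - w * cis t) powr (- of_real c)))\<^sup>2)"
    using parseval[OF w] sums_mult[OF sums_eval_fps[OF x_rad(1)], of "2 * pi"] sums_unique2
    unfolding x_def by blast
  then have "2 * pi * ((1 - x) powr (\<alpha> + 1) * eval_fps F x)
     = integral {0..2 * pi} (\<lambda>t. (1 - x) powr (\<alpha> + 1) * (norm ((1 - w * cis t) powr (- of_real c)))\<^sup>2)"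
    by simp
  also have "\<dots> = integral {0..2 * pi} (\<lambda>t. norm (weighted_poisson \<alpha> (w * cis t)))"
  proof (rule integral_cong)
    fix t
    have "norm (w * cis t) < 1" using w by (simp add: norm_mult)
    then have "1 - w * cis t \<noteq> 0" by auto
    then have n: "norm (1 - w * cis t) > 0" by simp
    have "(norm ((1 - w * cis t) powr (- of_real c)))\<^sup>2 = norm (1 - w * cis t) powr (- c) * norm (1 - w * cis t) powr (- c)"
      by (simp add: norm_powr_real_powr' power2_eq_square)
    also have "\<dots> = norm (1 - w * cis t) powr (- 1) * norm (1 - w * cis t) powr (- (\<alpha> + 1))"
      by (simp only: powr_add[symmetric]) (simp add: c_def algebra_simps)
    also have "\<dots> = norm (1 / (1 - w * cis t)) * norm ((1 - w * cis t) powr (- of_real (\<alpha> + 1)))"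
    proof -
      have "norm (1 - w * cis t) powr (- 1) = norm (1 / (1 - w * cis t))"
        using n by (simp add: powr_minus_divide norm_divide)
      moreover have "norm ((1 - w * cis t) powr (- of_real (\<alpha> + 1))) = norm (1 - w * cis t) powr (- (\<alpha> + 1))"
        by (subst norm_powr_real_powr') auto
      ultimately show ?thesis by (simp only:)
    qed
    finally show "(1 - x) powr (\<alpha> + 1) * (norm ((1 - w * cis t) powr (- of_real c)))\<^sup>2
        = norm (weighted_poisson \<alpha> (w * cis t))"
      by (simp add: weighted_poisson_def x_def norm_mult norm_divide)
  qed
  finally show ?thesis by (simp add: x_def)
qed

section \<open>The essential supremum as a pointwise bound, and the boundary limits of Fourier
  coefficients\<close>

section \<open>Boundary values\<close>

text \<open>If the bound failed at one point, continuity would make it fail on an interval of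
  angles, which has positive length.\<close>

lemma norm_le_circle_Linf_norm:
  assumes g: "continuous_on (sphere 0 1) g" and z: "norm z = 1"
  shows "ereal (norm (g z)) \<le> circle_Linf_norm g"
proof (rule ccontr)
  define N where "N = circle_Linf_norm g"
  define h where "h = (\<lambda>t. ereal (norm (g (cis t))))"
  obtain t0 where t0: "t0 \<in> {0..<2 * pi}" "z = cis t0"
    using norm_eq_1_imp_cis[OF z] by blast
  assume "\<not> ereal (norm (g z)) \<le> circle_Linf_norm g"
  then have less: "N < h t0" by (simp add: N_def h_def t0)
  have "AE t in restrict_space lborel {0..<2 * pi}. h t \<le> N"
    using AE_distrD[OF cis_measurable_circle, of "\<lambda>z. ereal (norm (g z)) \<le> N"]
      esssup_AE[of "\<lambda>z. ereal (norm (g z))" circle_measure]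
    unfolding N_def h_def circle_Linf_norm_def circle_measure_def by blast
  then have AE: "AE t in lborel. t \<in> {0..<2 * pi} \<longrightarrow> h t \<le> N"
    by (subst (asm) AE_restrict_space_iff) auto
  have "continuous_on UNIV h"
    unfolding h_def by (intro continuous_on_ereal continuous_on_norm continuous_on_circle_cis[OF g] continuous_on_id)
  then have "open {t. N < h t}"
    by (intro open_Collect_less) auto
  \<comment> \<open>Staying below 2 pi keeps an interval to the right of \<open>t0\<close> inside
    the parameter range, also when \<open>t0\<close> is 0.\<close>
  then have "open ({t. N < h t} \<inter> {..<2 * pi})" by auto
  moreover have "t0 \<in> {t. N < h t} \<inter> {..<2 * pi}" using less t0 by simp
  ultimately obtain e where e: "e > 0" "ball t0 e \<subseteq> {t. N < h t} \<inter> {..<2 * pi}"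
    using open_contains_ball by blast
  have "t \<notin> {t0<..<t0 + e}" if "t \<in> {0..<2 * pi} \<longrightarrow> h t \<le> N" for t
  proof
    assume t: "t \<in> {t0<..<t0 + e}"
    then have "t \<in> ball t0 e" by (simp add: dist_real_def)
    then have "N < h t" "t < 2 * pi" using e(2) by auto
    then show False using that t t0 by auto
  qed
  then have "AE t in lborel. t \<notin> {t0<..<t0 + e}"
    using AE by (auto elim!: eventually_mono)
  then have "{t0<..<t0 + e} \<in> null_sets lborel"
    by (subst AE_iff_null_sets) auto
  then show False using e(1) by (simp add: null_sets_def)
qed

lemma circle_Linf_norm_le:
  assumes "continuous_on (sphere 0 1) g" "\<And>z. norm z = 1 \<Longrightarrow> norm (g z) \<le> B"
  shows "circle_Linf_norm g \<le> ereal B"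
  unfolding circle_Linf_norm_def
proof (rule esssup_I)
  have "g \<in> borel_measurable (restrict_space borel (sphere 0 1))"
    by (rule borel_measurable_continuous_on_restrict[OF assms(1)])
  then show "(\<lambda>z. ereal (norm (g z))) \<in> borel_measurable circle_measure"
    by (simp add: circle_measure_def)
  show "AE z in circle_measure. ereal (norm (g z)) \<le> ereal B"
    by (rule AE_I2) (simp add: circle_measure_def space_restrict_space assms(2))
qed

text \<open>A real value for the norm reduces the extended-real product in the final estimate to
  real arithmetic.\<close>

lemma circle_Linf_norm_finite:
  assumes "continuous_on (sphere 0 1) g"
  obtains N where "circle_Linf_norm g = ereal N" "\<And>z. norm z = 1 \<Longrightarrow> norm (g z) \<le> N"
proof -
  have "compact (g ` sphere 0 1)"
    using assms by (intro compact_continuous_image) auto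
  then obtain B where "\<And>z. norm z = 1 \<Longrightarrow> norm (g z) \<le> B"
    by (force dest!: compact_imp_bounded simp: bounded_iff)
  then have "circle_Linf_norm g \<le> ereal B" by (intro circle_Linf_norm_le assms)
  moreover have "ereal (norm (g 1)) \<le> circle_Linf_norm g"
    by (intro norm_le_circle_Linf_norm assms) simp
  ultimately obtain N where "circle_Linf_norm g = ereal N"
    by (cases "circle_Linf_norm g") auto
  then show ?thesis
    using that norm_le_circle_Linf_norm[OF assms] by simp
qed

text \<open>Connects the Lebesgue integral in the boundary condition with the gauge integral in
  \<open>fourier\<close>; the endpoint 2 pi is a null set.\<close>

lemma integral_circle_measure_HK:
  fixes g :: "complex \<Rightarrow> complex"
  assumes "continuous_on (sphere 0 1) g"
  shows "(\<integral>z. g z \<partial>circle_measure) = integral {0..2 * pi} (\<lambda>t. g (cis t))"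
proof -
  have "continuous_on {0..2 * pi} (\<lambda>t. g (cis t))"
    by (intro continuous_on_circle_cis[OF assms] continuous_on_id)
  then have "set_integrable lborel {0..2 * pi} (\<lambda>t. g (cis t))"
    by (rule borel_integrable_atLeastAtMost')
  then have "set_integrable lborel {0..<2 * pi} (\<lambda>t. g (cis t))"
    by (rule set_integrable_subset) auto
  then have "(LINT t:{0..<2 * pi}|lborel. g (cis t)) = integral {0..<2 * pi} (\<lambda>t. g (cis t))"
    by (rule set_borel_integral_eq_integral(2))
  also have "\<dots> = integral {0..2 * pi} (\<lambda>t. g (cis t))"
    by (rule integral_subset_negligible) (auto intro!: negligible_subset[OF negligible_sing[of "2 * pi"]])
  finally show ?thesis by (simp add: integral_circle_measure[OF assms])
qed

lemma cis_powi: "cis t powi n = cis (of_int n * t)"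
  by (cases n) (auto simp: power_int_def Complex.DeMoivre cis_inverse[symmetric] field_simps)

lemma circle_test_function_powi: "circle_test_function (\<lambda>z. z powi n)"
  unfolding circle_test_function_def
proof (intro exI[of _ "\<lambda>k t. (\<i> * of_int n) ^ k * cis (of_int n * t)"] conjI allI)
  fix k t
  show "((\<lambda>t. (\<i> * of_int n) ^ k * cis (of_int n * t)) has_vector_derivative
      (\<i> * of_int n) ^ Suc k * cis (of_int n * t)) (at t)"
    using has_vector_derivative_mult_right[OF has_vector_derivative_cis[of "of_int n" t UNIV],
        of "(\<i> * of_int n) ^ k"] by (simp add: mult_ac)
qed (simp add: cis_powi)

text \<open>The characters are test functions, and testing against the one of index
  \<open>- n\<close> gives exactly the coefficient of index \<open>n\<close>.\<close>

lemma fourier_boundary_value: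
  assumes f: "continuous_on (ball 0 1) f" and g: "continuous_on (sphere 0 1) g"
    and fg: "distributional_boundary_value f g"
  shows "((\<lambda>r. fourier (\<lambda>\<zeta>. f (of_real r * \<zeta>)) n) \<longlongrightarrow> fourier g n) (at_left 1)"
proof -
  have eq: "(\<integral>\<zeta>. u \<zeta> * \<zeta> powi (- n) \<partial>circle_measure) = fourier u n"
    if "continuous_on (sphere 0 1) u" for u
  proof -
    have "continuous_on (sphere 0 1) (\<lambda>\<zeta>. u \<zeta> * \<zeta> powi (- n))"
      using that by (intro continuous_on_mult continuous_on_power_int continuous_on_id) auto
    then show ?thesis
      by (simp add: integral_circle_measure_HK fourier_def cis_powi)
  qed
  have "((\<lambda>r. \<integral>\<zeta>. f (of_real r * \<zeta>) * \<zeta> powi (- n) \<partial>circle_measure) \<longlongrightarrow> fourier g n) (at_left 1)"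
    using fg[unfolded distributional_boundary_value_def, rule_format, OF circle_test_function_powi[of "- n"]]
    unfolding eq[OF g] .
  moreover have "\<forall>\<^sub>F r in at_left 1. (\<integral>\<zeta>. f (of_real r * \<zeta>) * \<zeta> powi (- n) \<partial>circle_measure)
      = fourier (\<lambda>\<zeta>. f (of_real r * \<zeta>)) n"
  proof -
    have "continuous_on (sphere 0 1) (\<lambda>\<zeta>. f (of_real r * \<zeta>))" if "0 < r" "r < 1" for r
      by (rule continuous_on_compose2[OF f])
         (use that in \<open>auto intro!: continuous_on_mult continuous_on_id continuous_on_const simp: norm_mult\<close>)
    then show ?thesis
      using eq by (auto simp: eventually_at_left_field intro!: exI[of _ 0])
  qed
  ultimately show ?thesis by (simp add: tendsto_cong)
qed

lemma fourier_dirichlet_solution: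
  assumes f: "C2_on f (ball 0 1)" "\<And>z. z \<in> ball 0 1 \<Longrightarrow> weighted_laplacian \<alpha> f z = 0" and \<alpha>: "\<alpha> > -1"
    and cont: "continuous_on (ball 0 1) f"
    and g: "continuous_on (sphere 0 1) g" and fg: "distributional_boundary_value f g"
    and r: "0 < r" "r < 1"
  shows "fourier (\<lambda>\<zeta>. f (of_real r * \<zeta>)) (int n) = fourier g (int n) * of_real r ^ n"
    and "of_real r ^ Suc m * fourier (\<lambda>\<zeta>. f (of_real r * \<zeta>)) (- int (Suc m)) =
      fourier g (- int (Suc m)) * of_real (binomial_tail (\<alpha> + 1) (Suc m) (r\<^sup>2))"
proof -
  note lim = fourier_boundary_value[OF cont g fg]
  have ev: "\<forall>\<^sub>F r in at_left 1. P r" if "\<And>r::real. r \<in> {0<..<1} \<Longrightarrow> P r" for P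
    using that by (auto simp: eventually_at_left_field intro!: exI[of _ 0])
  show "fourier (\<lambda>\<zeta>. f (of_real r * \<zeta>)) (int n) = fourier g (int n) * of_real r ^ n"
  proof -
    obtain c where c: "\<And>r. r \<in> {0<..<1} \<Longrightarrow> fourier (\<lambda>\<zeta>. f (of_real r * \<zeta>)) (int n) = c * of_real r ^ n"
      using fourier_weighted_harmonic(1)[OF f \<alpha>] by blast
    have "((\<lambda>r::real. c * of_real r ^ n) \<longlongrightarrow> c * of_real 1 ^ n) (at_left 1)"
      by (intro tendsto_intros)
    moreover have "((\<lambda>r::real. c * of_real r ^ n) \<longlongrightarrow> fourier g (int n)) (at_left 1)"
      using lim[of "int n"] tendsto_cong[OF ev[OF c]] by simp
    ultimately have "c = fourier g (int n)"
      using tendsto_unique[OF trivial_limit_at_left_real] by fastforce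
    then show ?thesis using c r by simp
  qed
  show "of_real r ^ Suc m * fourier (\<lambda>\<zeta>. f (of_real r * \<zeta>)) (- int (Suc m)) =
      fourier g (- int (Suc m)) * of_real (binomial_tail (\<alpha> + 1) (Suc m) (r\<^sup>2))"
  proof -
    obtain c where c: "\<And>r. r \<in> {0<..<1} \<Longrightarrow> of_real r ^ Suc m * fourier (\<lambda>\<zeta>. f (of_real r * \<zeta>)) (- int (Suc m)) =
        c * of_real (binomial_tail (\<alpha> + 1) (Suc m) (r\<^sup>2))"
      using fourier_weighted_harmonic(2)[OF f \<alpha>] by blast
    have "((\<lambda>r::real. r\<^sup>2) \<longlongrightarrow> 1\<^sup>2) (at_left 1)"
      by (intro tendsto_intros)
    \<comment> \<open>The squared radius approaches 1 from below, so it may be inserted into the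
      one-sided limit of \<open>binomial_tail\<close>.\<close>
    then have "filterlim (\<lambda>r::real. r\<^sup>2) (at_left 1) (at_left 1)"
      unfolding filterlim_at by (auto intro!: ev simp: abs_square_less_1 abs_square_eq_1)
    from filterlim_compose[OF binomial_tail_tendsto_1 this]
    have "((\<lambda>r. binomial_tail (\<alpha> + 1) (Suc m) (r\<^sup>2)) \<longlongrightarrow> 1) (at_left 1)"
      using \<alpha> by simp
    then have "((\<lambda>r. c * of_real (binomial_tail (\<alpha> + 1) (Suc m) (r\<^sup>2))) \<longlongrightarrow> c * of_real 1) (at_left 1)"
      by (intro tendsto_intros)
    moreover have "((\<lambda>r. of_real r ^ Suc m * fourier (\<lambda>\<zeta>. f (of_real r * \<zeta>)) (- int (Suc m))) \<longlongrightarrow>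
        of_real 1 ^ Suc m * fourier g (- int (Suc m))) (at_left 1)"
      by (intro tendsto_mult tendsto_power tendsto_of_real tendsto_ident_at lim)
    then have "((\<lambda>r. c * of_real (binomial_tail (\<alpha> + 1) (Suc m) (r\<^sup>2))) \<longlongrightarrow> fourier g (- int (Suc m))) (at_left 1)"
      using tendsto_cong[OF ev[OF c]] by simp
    ultimately have "c = fourier g (- int (Suc m))"
      using tendsto_unique[OF trivial_limit_at_left_real] by fastforce
    then show ?thesis using c r by simp
  qed
qed

section \<open>The solution as a convolution with the kernel, and the resulting bound\<close>

section \<open>Poisson representation\<close>

text \<open>Turns the reflected angle \<open>- s\<close> of the convolution into \<open>s\<close>,
  for which the mean of the modulus has been computed.\<close>

lemma norm_weighted_poisson_cnj: "norm (weighted_poisson \<alpha> (cnj z)) = norm (weighted_poisson \<alpha> z)"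
proof -
  have "norm (1 - cnj z) = norm (1 - z)"
    using complex_mod_cnj[of "1 - z"] by simp
  moreover have "norm (u powr (- of_real (\<alpha> + 1))) = norm u powr (- (\<alpha> + 1))" for u :: complex
    by (subst norm_powr_real_powr') auto
  ultimately show ?thesis
    by (simp only: weighted_poisson_def norm_mult norm_divide norm_of_real complex_mod_cnj)
qed

text \<open>A convolution over the circle: for z = r \<open>cis t\<close> the kernel is evaluated at
  r \<open>cis (t - s)\<close>.\<close>

definition weighted_poisson_integral :: "real \<Rightarrow> (complex \<Rightarrow> complex) \<Rightarrow> complex \<Rightarrow> complex" where
  "weighted_poisson_integral \<alpha> g z =
     integral {0..2 * pi} (\<lambda>s. weighted_poisson \<alpha> (z * cis (- s)) * g (cis s)) / of_real (2 * pi)"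

lemma continuous_on_weighted_poisson_integral:
  assumes g: "continuous_on (sphere 0 1) g"
  shows "continuous_on (ball 0 1) (weighted_poisson_integral \<alpha> g)"
proof -
  have "continuous_on (ball 0 1 \<times> cbox 0 (2 * pi))
     (\<lambda>p. weighted_poisson \<alpha> (fst p * cis (- snd p)) * g (cis (snd p)))"
    by (intro continuous_on_mult continuous_on_circle_cis[OF g] continuous_on_snd continuous_on_id
        continuous_on_compose2[OF continuous_on_weighted_poisson]
        continuous_on_fst continuous_on_cis continuous_on_minus) (auto simp: norm_mult)
  then have "continuous_on (ball 0 1) (\<lambda>z. integral (cbox 0 (2 * pi)) (\<lambda>s. weighted_poisson \<alpha> (z * cis (- s)) * g (cis s)))"
    by (intro integral_continuous_on_param) (simp add: split_beta)
  then show ?thesis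
    unfolding weighted_poisson_integral_def[abs_def] by (intro continuous_on_divide continuous_on_const) auto
qed

text \<open>The order of integration may be exchanged because the integrand is continuous on the
  square of angles.\<close>

lemma fourier_weighted_poisson_integral:
  assumes g: "continuous_on (sphere 0 1) g" and r: "0 < r" "r < 1"
  shows "fourier (\<lambda>\<zeta>. weighted_poisson_integral \<alpha> g (of_real r * \<zeta>)) n =
    integral {0..2 * pi} (\<lambda>s. fourier (\<lambda>\<zeta>. weighted_poisson \<alpha> (of_real r * cis (- s) * \<zeta>)) n * g (cis s)) / of_real (2 * pi)"
proof -
  let ?h = "\<lambda>t s. weighted_poisson \<alpha> (of_real r * cis t * cis (- s)) * g (cis s) * cis (- (of_int n * t))"
  have "continuous_on (cbox (0, 0) (2 * pi, 2 * pi)) (\<lambda>p. ?h (fst p) (snd p))"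
    by (intro continuous_on_mult continuous_on_circle_cis[OF g] continuous_on_fst continuous_on_snd continuous_on_id
        continuous_on_compose2[OF continuous_on_weighted_poisson] continuous_on_const
        continuous_on_cis continuous_on_minus) (use r in \<open>auto simp: norm_mult\<close>)
  then have swap: "integral {0..2 * pi} (\<lambda>t. integral {0..2 * pi} (?h t)) =
      integral {0..2 * pi} (\<lambda>s. integral {0..2 * pi} (\<lambda>t. ?h t s))"
    using integral_swap_continuous[of 0 0 "2 * pi" "2 * pi" ?h] by (simp add: split_beta)
  have inner: "integral {0..2 * pi} (\<lambda>t. ?h t s) =
      fourier (\<lambda>\<zeta>. weighted_poisson \<alpha> (of_real r * cis (- s) * \<zeta>)) n * g (cis s)" for s
    unfolding fourier_def integral_mult_left[symmetric] by (simp add: mult_ac)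
  have "fourier (\<lambda>\<zeta>. weighted_poisson_integral \<alpha> g (of_real r * \<zeta>)) n
      = integral {0..2 * pi} (\<lambda>t. integral {0..2 * pi} (?h t)) / of_real (2 * pi)"
    by (simp add: fourier_def weighted_poisson_integral_def)
  also have "\<dots> = integral {0..2 * pi} (\<lambda>s. fourier (\<lambda>\<zeta>. weighted_poisson \<alpha> (of_real r * cis (- s) * \<zeta>)) n * g (cis s))
      / of_real (2 * pi)"
    by (simp only: swap inner)
  finally show ?thesis .
qed

text \<open>Both sides are continuous on the circle through \<open>z\<close> and have the same
  Fourier coefficients there. The rotation \<open>cis (- s)\<close> in the kernel contributes the
  character that turns the remaining integral into a coefficient of \<open>g\<close>.\<close>

lemma dirichlet_solution_eq_weighted_poisson_integral:
  assumes f: "C2_on f (ball 0 1)" "\<And>z. z \<in> ball 0 1 \<Longrightarrow> weighted_laplacian \<alpha> f z = 0" and \<alpha>: "\<alpha> > -1"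
    and cont: "continuous_on (ball 0 1) f"
    and g: "continuous_on (sphere 0 1) g" and fg: "distributional_boundary_value f g"
    and z: "z \<in> ball 0 1" "z \<noteq> 0"
  shows "f z = weighted_poisson_integral \<alpha> g z"
proof -
  define r where "r = norm z"
  have r: "0 < r" "r < 1" using z by (auto simp: r_def)
  have circ: "continuous_on (sphere 0 1) (\<lambda>\<zeta>. u (of_real r * \<zeta>))" if "continuous_on (ball 0 1) u"
    for u :: "complex \<Rightarrow> complex"
    by (rule continuous_on_compose2[OF that])
       (use r in \<open>auto intro!: continuous_on_mult continuous_on_id continuous_on_const simp: norm_mult\<close>)
  have cf: "continuous_on (sphere 0 1) (\<lambda>\<zeta>. f (of_real r * \<zeta>))"
    and cv: "continuous_on (sphere 0 1) (\<lambda>\<zeta>. weighted_poisson_integral \<alpha> g (of_real r * \<zeta>))"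
    by (intro circ cont continuous_on_weighted_poisson_integral g)+
  note sol = fourier_dirichlet_solution[OF f \<alpha> cont g fg r]
  have "fourier (\<lambda>\<zeta>. f (of_real r * \<zeta>)) n = fourier (\<lambda>\<zeta>. weighted_poisson_integral \<alpha> g (of_real r * \<zeta>)) n" for n
  proof (cases n)
    case (nonneg k)
    have "fourier (\<lambda>\<zeta>. weighted_poisson \<alpha> (of_real r * cis (- s) * \<zeta>)) n * g (cis s)
        = (of_real (2 * pi) * of_real r ^ k) * (g (cis s) * cis (- (of_int n * s)))" for s
      using fourier_weighted_poisson(1)[of "of_real r * cis (- s)" \<alpha> k] r nonneg
      by (simp add: norm_mult power_mult_distrib Complex.DeMoivre mult_ac)
    then have "integral {0..2 * pi} (\<lambda>s. fourier (\<lambda>\<zeta>. weighted_poisson \<alpha> (of_real r * cis (- s) * \<zeta>)) n * g (cis s))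
        = (of_real (2 * pi) * of_real r ^ k) * fourier g n"
      unfolding fourier_def[of g] integral_mult_right[symmetric] by (simp only:)
    then show ?thesis
      unfolding fourier_weighted_poisson_integral[OF g r] using sol(1)[of k] nonneg
      by simp
  next
    case (neg k)
    have "of_real r ^ Suc k * (fourier (\<lambda>\<zeta>. weighted_poisson \<alpha> (of_real r * cis (- s) * \<zeta>)) n * g (cis s))
        = (of_real (2 * pi) * of_real (binomial_tail (\<alpha> + 1) (Suc k) (r\<^sup>2))) * (g (cis s) * cis (- (of_int n * s)))" for s
    proof -
      \<comment> \<open>Here \<open>n\<close> is \<open>- Suc k\<close>, so the two rotations are
        inverse to each other.\<close>
      have c: "(of_real r * cis (- s)) ^ Suc k * cis (- (of_int n * s)) = of_real r ^ Suc k"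
        unfolding power_mult_distrib Complex.DeMoivre neg
        by (simp add: mult.assoc cis_mult algebra_simps del: power_Suc)
      have "of_real r ^ Suc k * (fourier (\<lambda>\<zeta>. weighted_poisson \<alpha> (of_real r * cis (- s) * \<zeta>)) n * g (cis s))
        = ((of_real r * cis (- s)) ^ Suc k * fourier (\<lambda>\<zeta>. weighted_poisson \<alpha> (of_real r * cis (- s) * \<zeta>)) n)
            * (g (cis s) * cis (- (of_int n * s)))"
        unfolding c[symmetric] by (simp only: mult_ac)
      also have "(of_real r * cis (- s)) ^ Suc k * fourier (\<lambda>\<zeta>. weighted_poisson \<alpha> (of_real r * cis (- s) * \<zeta>)) n
        = of_real (2 * pi * binomial_tail (\<alpha> + 1) (Suc k) (r\<^sup>2))"
        using fourier_weighted_poisson(2)[of "of_real r * cis (- s)" "Suc k" \<alpha>] r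
        unfolding neg by (simp add: norm_mult del: power_Suc of_nat_Suc)
      finally show ?thesis by simp
    qed
    then have "of_real r ^ Suc k * integral {0..2 * pi} (\<lambda>s. fourier (\<lambda>\<zeta>. weighted_poisson \<alpha> (of_real r * cis (- s) * \<zeta>)) n * g (cis s))
        = (of_real (2 * pi) * of_real (binomial_tail (\<alpha> + 1) (Suc k) (r\<^sup>2))) * fourier g n"
      unfolding fourier_def[of g] integral_mult_right[symmetric] by (simp only:)
    then have "of_real r ^ Suc k * fourier (\<lambda>\<zeta>. weighted_poisson_integral \<alpha> g (of_real r * \<zeta>)) n
        = of_real r ^ Suc k * fourier (\<lambda>\<zeta>. f (of_real r * \<zeta>)) n"
      unfolding fourier_weighted_poisson_integral[OF g r] times_divide_eq_right
      using sol(2)[of k] unfolding neg by simp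
    moreover have "of_real r ^ Suc k \<noteq> (0 :: complex)" using r by simp
    ultimately show ?thesis by (metis mult_cancel_left)
  qed
  then have "fourier (\<lambda>\<zeta>. f (of_real r * \<zeta>) - weighted_poisson_integral \<alpha> g (of_real r * \<zeta>)) n = 0" for n
    by (simp add: fourier_diff[OF cf cv])
  \<comment> \<open>The functions were rescaled to the unit circle, where \<open>z\<close>
    corresponds to the point \<open>z / r\<close>.\<close>
  from fourier_eq_0_imp_eq_0[OF continuous_on_diff[OF cf cv] this, of "z / of_real r"]
  show ?thesis using r by (simp add: r_def norm_divide)
qed

lemma norm_weighted_poisson_integral_le:
  assumes g: "continuous_on (sphere 0 1) g" and N: "\<And>\<zeta>. norm \<zeta> = 1 \<Longrightarrow> norm (g \<zeta>) \<le> N"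
    and z: "z \<in> ball 0 1"
  shows "norm (weighted_poisson_integral \<alpha> g z) \<le> hyp2F1 (- \<alpha> / 2) (- \<alpha> / 2) 1 ((norm z)\<^sup>2) * N"
proof -
  have cont: "continuous_on {0..2 * pi} (\<lambda>s. weighted_poisson \<alpha> (z * cis (- s)))"
    by (rule continuous_on_compose2[OF continuous_on_weighted_poisson])
       (use z in \<open>auto intro!: continuous_on_mult continuous_on_const continuous_on_cis continuous_on_minus continuous_on_id simp: norm_mult\<close>)
  have "norm (integral {0..2 * pi} (\<lambda>s. weighted_poisson \<alpha> (z * cis (- s)) * g (cis s)))
      \<le> integral {0..2 * pi} (\<lambda>s. norm (weighted_poisson \<alpha> (z * cis (- s))) * N)"
    by (intro integral_norm_bound_integral integrable_continuous_interval continuous_on_mult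
        continuous_on_norm cont continuous_on_circle_cis[OF g] continuous_on_id continuous_on_const)
       (auto simp: norm_mult intro!: mult_left_mono N)
  also have "\<dots> = integral {0..2 * pi} (\<lambda>s. norm (weighted_poisson \<alpha> (cnj z * cis s))) * N"
  proof -
    have "norm (weighted_poisson \<alpha> (z * cis (- s))) = norm (weighted_poisson \<alpha> (cnj z * cis s))" for s
      using norm_weighted_poisson_cnj[of \<alpha> "cnj z * cis s"] by (simp add: cis_cnj)
    then show ?thesis by simp
  qed
  also have "\<dots> = 2 * pi * hyp2F1 (- \<alpha> / 2) (- \<alpha> / 2) 1 ((norm z)\<^sup>2) * N"
    using z by (subst integral_norm_weighted_poisson) auto
  finally show ?thesis
    by (simp add: weighted_poisson_integral_def norm_divide field_simps)
qed

lemma norm_dirichlet_solution_le: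
  assumes f: "C2_on f (ball 0 1)" "\<And>z. z \<in> ball 0 1 \<Longrightarrow> weighted_laplacian \<alpha> f z = 0" and \<alpha>: "\<alpha> > -1"
    and g: "continuous_on (sphere 0 1) g" and fg: "distributional_boundary_value f g"
    and N: "\<And>\<zeta>. norm \<zeta> = 1 \<Longrightarrow> norm (g \<zeta>) \<le> N"
    and z: "z \<in> ball 0 1"
  shows "norm (f z) \<le> hyp2F1 (- \<alpha> / 2) (- \<alpha> / 2) 1 ((norm z)\<^sup>2) * N"
proof -
  obtain f' where "\<And>z. z \<in> ball 0 1 \<Longrightarrow> (f has_derivative blinfun_apply (f' z)) (at z)"
    using f(1) unfolding C2_on_def by blast
  from has_derivative_continuous[OF this] have cont: "continuous_on (ball 0 1) f"
    by (intro continuous_at_imp_continuous_on) blast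
  let ?v = "weighted_poisson_integral \<alpha> g"
  have v: "continuous_on (ball 0 1) ?v"
    by (rule continuous_on_weighted_poisson_integral[OF g])
  have eq: "f z = ?v z" if "z \<in> ball 0 1" "z \<noteq> 0" for z
    by (rule dirichlet_solution_eq_weighted_poisson_integral[OF f \<alpha> cont g fg that])
  \<comment> \<open>At the origin the circle degenerates; both functions are continuous there and
    agree on the punctured disk.\<close>
  have "f 0 = ?v 0"
  proof -
    have lim: "(f \<longlongrightarrow> f 0) (at 0)" "(?v \<longlongrightarrow> ?v 0) (at 0)"
      using cont v by (auto simp: continuous_on_eq_continuous_at isCont_def)
    have "\<forall>\<^sub>F z in at 0. f z = ?v z"
      using eq by (auto simp: eventually_at intro!: exI[of _ 1])
    from tendsto_cong[OF this] lim(2) have "(f \<longlongrightarrow> ?v 0) (at 0)" by blast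
    then show ?thesis by (rule tendsto_unique[OF at_neq_bot lim(1)])
  qed
  with eq z have "f z = ?v z" by (cases "z = 0") auto
  then show ?thesis
    using norm_weighted_poisson_integral_le[OF g N z] by simp
qed

theorem theorem2p3:
  fixes \<alpha> :: real and f fstar :: "complex \<Rightarrow> complex"
  assumes "\<alpha> > -1"
    and "continuous_on (sphere 0 1) fstar"
    and "C2_on f (ball 0 1)"
    and "\<forall>z\<in>ball 0 1. weighted_laplacian \<alpha> f z = 0"
    and "distributional_boundary_value f fstar"
  shows "\<forall>z\<in>ball 0 1.
    ereal (norm (f z)) \<le>
      ereal (hyp2F1 (- \<alpha> / 2) (- \<alpha> / 2) 1 ((norm z)\<^sup>2)) * circle_Linf_norm fstar"
proof
  fix z :: complex assume z: "z \<in> ball 0 1"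
  obtain N where N: "circle_Linf_norm fstar = ereal N" "\<And>\<zeta>. norm \<zeta> = 1 \<Longrightarrow> norm (fstar \<zeta>) \<le> N"
    using circle_Linf_norm_finite[OF assms(2)] by blast
  show "ereal (norm (f z)) \<le> ereal (hyp2F1 (- \<alpha> / 2) (- \<alpha> / 2) 1 ((norm z)\<^sup>2)) * circle_Linf_norm fstar"
    using norm_dirichlet_solution_le[of f \<alpha> fstar N z] assms z N by simp
qed

end
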